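(* Let $G$ be a connected reductive linear algebraic group over $k$ with Lie algebra $\mathfrak{g}$. For every regular $G$-connection $A$ there exists a positive integer $n$ such that the pull-back connection $n^*(A)$ is gauge equivalent to a connection in zero standard form, i.e. to $X\,d\log z$ for some $X\in\mathfrak{g}$ such that zero is the only rational eigenvalue of $\mathrm{ad}\,X$.
   Context: $k$ is an algebraically closed field of characteristic zero and $K=k((z))$. For a linear algebraic group $G$ over $k$ with Lie algebra $\mathfrak{g}$, put $\mathfrak{g}(K)=\mathfrak{g}\otimes_k K=\mathfrak{g}((z))$. A ($G$-)connection is an element of $\mathfrak{g}(K)\otimes_K\Omega=\mathfrak{g}(K)\,d\log z$, where $\Omega=K\,dz$ and $d\log z=z^{-1}dz$. The gauge group $G(K)$ acts on connections by $g[A\,d\log z]=\big(\mathrm{Ad}(g)(A)+\widehat{z\partial_z}(g)g^{-1}\big)\,d\log z$. Here $\widehat{z\partial_z}:G(K)\to G(K[\varepsilon])$ ($\varepsilon^2=0$) is induced by the $k$-algebra map $K\to K[\varepsilon]$, $f\mapsto f+z\frac{\partial f}{\partial z}\varepsilon$, and $\mathfrak{g}(K)$ is identified with $\ker(G(K[\varepsilon])\to G(K),\ \varepsilon\mapsto 0)$. For a closed subgroup $G\subset \mathrm{GL}_n$ this reads $g[A\,d\log z]=(gAg^{-1}+z\partial_z(g)g^{-1})\,d\log z$ with $z\partial_z$ applied entrywise. Two connections are gauge equivalent if they lie in the same $G(K)$-orbit. A connection is regular if it is gauge equivalent to an element of $\mathfrak{g}[[z]]\,d\log z$, where $\mathfrak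 g[[z]]=\mathfrak g\otimes_k k[[z]]$. For a positive integer $n$, the pull-back of connections is $n^*(A(z)\,d\log z)=n\,A(z^n)\,d\log z$. "Rational" means lying in $\mathbb{Q}\subset k$. *)

theory Defs
  imports
    "HOL-Analysis.Analysis"
    "HOL-Computational_Algebra.Computational_Algebra"
    "HOL-Library.Poly_Mapping"
    "HOL-Algebra.Coset"
begin

unbundle no Formal_Power_Series.fps_syntax

section \<open>Dual numbers\<close>

text \<open>\<open>Dual a b\<close> stands for \<open>a + b \<epsilon>\<close> in \<open>R[\<epsilon>]\<close>, \<open>\<epsilon>\<^sup>2 = 0\<close>.\<close>

datatype 'a dual = Dual (dual_std: 'a) (dual_eps: 'a)

instantiation dual :: (comm_ring_1) comm_ring_1
begin

definition zero_dual :: "'a dual" where "0 = Dual 0 0"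
definition one_dual :: "'a dual" where "1 = Dual 1 0"
definition plus_dual :: "'a dual \<Rightarrow> 'a dual \<Rightarrow> 'a dual" where
  "x + y = Dual (dual_std x + dual_std y) (dual_eps x + dual_eps y)"
definition uminus_dual :: "'a dual \<Rightarrow> 'a dual" where
  "- x = Dual (- dual_std x) (- dual_eps x)"
definition minus_dual :: "'a dual \<Rightarrow> 'a dual \<Rightarrow> 'a dual" where
  "x - y = Dual (dual_std x - dual_std y) (dual_eps x - dual_eps y)"
definition times_dual :: "'a dual \<Rightarrow> 'a dual \<Rightarrow> 'a dual" where
  "x * y = Dual (dual_std x * dual_std y) (dual_std x * dual_eps y + dual_eps x * dual_std y)"

instance
  by standard
    (auto simp: zero_dual_def one_dual_def plus_dual_def uminus_dual_def minus_dual_def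
      times_dual_def algebra_simps)

end

abbreviation dual_const :: "'a::comm_ring_1 \<Rightarrow> 'a dual" where
  "dual_const a \<equiv> Dual a 0"

section \<open>Linear algebraic groups\<close>

text \<open>Polynomials over \<open>'k\<close> in the matrix entries \<open>x\<^sub>i\<^sub>j\<close>: finitely supported families of
  coefficients indexed by exponent vectors.\<close>

type_synonym ('k, 'n) entry_poly = "(('n \<times> 'n) \<Rightarrow>\<^sub>0 nat) \<Rightarrow>\<^sub>0 'k"

text \<open>The value of such a polynomial at a matrix over a \<open>'k\<close>-algebra \<open>'r\<close> with structure
  homomorphism \<open>\<phi>\<close>.\<close>

definition eval_entries ::
  "('k::zero \<Rightarrow> 'r::comm_ring_1) \<Rightarrow> 'r^'n^'n \<Rightarrow> ('k, 'n) entry_poly \<Rightarrow> 'r" where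
  "eval_entries \<phi> g p =
    (\<Sum>m\<in>Poly_Mapping.keys p. \<phi> (Poly_Mapping.lookup p m) *
      (\<Prod>(i, j)\<in>Poly_Mapping.keys m. (g $ i $ j) ^ Poly_Mapping.lookup m (i, j)))"

definition GL :: "('r::comm_ring_1^'n^'n) monoid" where
  "GL = \<lparr>carrier = {g. invertible g}, mult = (**), one = mat 1\<rparr>"

text \<open>The closed subsets of \<open>GL\<^sub>n(k)\<close> in the Zariski topology. Polynomials in \<open>x\<^sub>i\<^sub>j\<close> and the inverse
  of the determinant would give the same sets.\<close>

definition zariski_closed :: "('k::field^'n^'n) set \<Rightarrow> bool" where
  "zariski_closed Z \<longleftrightarrow>
    (\<exists>S. Z = {g \<in> carrier GL. \<forall>p\<in>S. eval_entries (\<lambda>a. a) g p = 0})"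

text \<open>A linear algebraic group over the algebraically closed field \<open>'k\<close> of characteristic zero,
  embedded in some \<open>GL\<^sub>n\<close> and given by its \<open>'k\<close>-points.\<close>

definition linear_algebraic_group :: "('k::field^'n^'n) set \<Rightarrow> bool" where
  "linear_algebraic_group G \<longleftrightarrow> subgroup G GL \<and> zariski_closed G"

definition zariski_connected :: "('k::field^'n^'n) set \<Rightarrow> bool" where
  "zariski_connected G \<longleftrightarrow>
    \<not> (\<exists>C D. zariski_closed C \<and> zariski_closed D \<and> G \<subseteq> C \<union> D \<and>
          C \<inter> D \<inter> G = {} \<and> C \<inter> G \<noteq> {} \<and> D \<inter> G \<noteq> {})"

definition unipotent :: "'k::field^'n^'n \<Rightarrow> bool" where
  "unipotent g \<longleftrightarrow> (\<exists>m::nat. (((**) (g - mat 1)) ^^ m) (mat 1) = 0)"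

text \<open>The unipotent radical, the largest connected normal unipotent closed subgroup, is trivial.\<close>

definition reductive :: "('k::field^'n^'n) set \<Rightarrow> bool" where
  "reductive G \<longleftrightarrow>
    (\<forall>U. U \<lhd> GL\<lparr>carrier := G\<rparr> \<and> zariski_closed U \<and> zariski_connected U \<and>
         (\<forall>u\<in>U. unipotent u) \<longrightarrow> U = {mat 1})"

text \<open>The points of \<open>G\<close> in the \<open>'k\<close>-algebra \<open>'r\<close>: the coordinate ring of \<open>G\<close> is the quotient of
  \<open>k[x\<^sub>i\<^sub>j, 1/det]\<close> by the ideal generated by the polynomials vanishing on \<open>G\<close>.\<close>

definition vanishing_ideal :: "('k::field^'n^'n) set \<Rightarrow> ('k, 'n) entry_poly set" where
  "vanishing_ideal G = {p. \<forall>g\<in>G. eval_entries (\<lambda>a. a) g p = 0}"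

definition points ::
  "('k::field \<Rightarrow> 'r::comm_ring_1) \<Rightarrow> ('k^'n^'n) set \<Rightarrow> ('r^'n^'n) set" where
  "points \<phi> G = {g \<in> carrier GL. \<forall>p\<in>vanishing_ideal G. eval_entries \<phi> g p = 0}"

text \<open>The kernel of \<open>G(k[\<epsilon>]) \<rightarrow> G(k)\<close>; the matrix below is \<open>1 + \<epsilon>X\<close>.\<close>

definition lie_algebra :: "('k::field^'n^'n) set \<Rightarrow> ('k^'n^'n) set" where
  "lie_algebra G = {X. (\<chi> i j. Dual (mat 1 $ i $ j) (X $ i $ j)) \<in> points dual_const G}"

definition ad_eigenvalue :: "('k::field^'n^'n) set \<Rightarrow> 'k^'n^'n \<Rightarrow> 'k \<Rightarrow> bool" where
  "ad_eigenvalue G X c \<longleftrightarrow>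
    (\<exists>Y\<in>lie_algebra G. Y \<noteq> 0 \<and> X ** Y - Y ** X = map_matrix ((*) c) Y)"

section \<open>Connections\<close>

text \<open>Throughout, a matrix \<open>A\<close> over \<open>k((z))\<close> represents \<open>A d log z\<close>.
  The set of connections is \<open>\<gg>((z))\<close>: Laurent series all of whose coefficients lie in \<open>\<gg>\<close>. As \<open>\<gg>\<close> is
  finite-dimensional, this is the tensor product of \<open>\<gg>\<close> with \<open>k((z))\<close>.\<close>

definition connections :: "('k::field^'n^'n) set \<Rightarrow> ('k fls^'n^'n) set" where
  "connections G = {A. \<forall>m::int. map_matrix (\<lambda>f. fls_nth f m) A \<in> lie_algebra G}"

text \<open>The connections in \<open>\<gg>[[z]] d log z\<close>.\<close>

definition log_connections :: "('k::field^'n^'n) set \<Rightarrow> ('k fls^'n^'n) set" where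
  "log_connections G =
    {A \<in> connections G. \<forall>m<0. map_matrix (\<lambda>f. fls_nth f m) A = 0}"

definition gauge :: "'k::field fls^'n^'n \<Rightarrow> 'k fls^'n^'n \<Rightarrow> 'k fls^'n^'n" where
  "gauge g A =
    g ** A ** matrix_inv g + map_matrix (\<lambda>f. fls_X * fls_deriv f) g ** matrix_inv g"

definition gauge_equivalent ::
  "('k::field^'n^'n) set \<Rightarrow> 'k fls^'n^'n \<Rightarrow> 'k fls^'n^'n \<Rightarrow> bool" where
  "gauge_equivalent G A B \<longleftrightarrow>
    A \<in> connections G \<and> B \<in> connections G \<and> (\<exists>g\<in>points fls_const G. gauge g A = B)"

definition regular_connection :: "('k::field^'n^'n) set \<Rightarrow> 'k fls^'n^'n \<Rightarrow> bool" where
  "regular_connection G A \<longleftrightarrow> (\<exists>B\<in>log_connections G. gauge_equivalent G A B)"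

definition pullback :: "nat \<Rightarrow> 'k::field fls^'n^'n \<Rightarrow> 'k fls^'n^'n" where
  "pullback n A = map_matrix (\<lambda>f. of_nat n * fls_compose_power f n) A"

text \<open>The condition on eigenvalues reads: every rational eigenvalue is zero. If \<open>\<gg> \<noteq> 0\<close> then zero is
  automatically an eigenvalue; if \<open>\<gg> = 0\<close> there are no eigenvalues at all.\<close>

definition zero_standard_form ::
  "('k::field_char_0^'n^'n) set \<Rightarrow> 'k fls^'n^'n \<Rightarrow> bool" where
  "zero_standard_form G B \<longleftrightarrow>
    (\<exists>X\<in>lie_algebra G. B = map_matrix fls_const X \<and>
       (\<forall>c\<in>\<rat>. ad_eigenvalue G X c \<longrightarrow> c = 0))"

end

theory Submission
  imports Defs
begin

text \<open>
  Write \<open>K = k((z))\<close>, let \<open>I\<close> be the ideal of \<open>G\<close> and \<open>\<gg>\<close> its Lie algebra. A regular connection is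
  gauge equivalent to some \<open>A = \<Sum> A\<^sub>m z\<^sup>m\<close> with all \<open>A\<^sub>m\<close> in \<open>\<gg>\<close> and \<open>m \<ge> 0\<close>, and pulling back is
  compatible with gauge transformations. So the task is to bring \<open>n\<^sup>*A\<close> into zero standard form for
  a suitable \<open>n\<close>. Fix a \<open>\<rat>\<close>-linear map \<open>f : k \<rightarrow> \<rat>\<close> with \<open>f 1 = 1\<close>. The pull-back multiplies the
  residue \<open>A\<^sub>0\<close> by \<open>n\<close>, so for a common denominator \<open>n\<close> the number \<open>f c\<close> is an integer for every
  eigenvalue \<open>c\<close> of the new residue, again called \<open>A\<^sub>0\<close>. Let \<open>D\<close> act on the generalised eigenspace
  of \<open>A\<^sub>0\<close> for \<open>c\<close> as the scalar \<open>f c\<close>.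

  The resonant part of \<open>A\<close> is isolated first (\<open>resonant_normal_form\<close>): some \<open>g\<close> in \<open>G(k[[z]])\<close> with
  \<open>g(0) = 1\<close> turns \<open>A\<close> into \<open>B = \<Sum> B\<^sub>m z\<^sup>m\<close> where \<open>B\<^sub>0 = A\<^sub>0\<close> and \<open>B\<^sub>m\<close> lies in the generalised
  eigenspace of \<open>ad A\<^sub>0\<close> for the eigenvalue \<open>m\<close>. Since \<open>f\<close> is additive and \<open>f m = m\<close>, this implies
  \<open>[D, B\<^sub>m] = m B\<^sub>m\<close>. In particular almost all \<open>B\<^sub>m\<close> vanish, and \<open>z\<^sup>-\<^sup>D\<close> conjugates \<open>B\<^sub>m z\<^sup>m\<close> to \<open>B\<^sub>m\<close>.
  The gauge transformation by \<open>z\<^sup>-\<^sup>D\<close> therefore gives the constant connection \<open>X = \<Sum> B\<^sub>m - D\<close>. As the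
  \<open>B\<^sub>m\<close> with \<open>m > 0\<close> raise the grading by eigenspaces of \<open>D\<close>, the eigenvalues of \<open>X\<close> are those of
  \<open>A\<^sub>0 - D\<close>, that is, the numbers \<open>c - f c\<close>, and these lie in the kernel of \<open>f\<close>. An eigenvalue of
  \<open>ad X\<close> is a difference of two eigenvalues of \<open>X\<close>, so it lies in the kernel of \<open>f\<close> too, and a
  rational number in this kernel is zero.

  Two facts on algebraic groups enter, and both rest on the observation that for \<open>X\<close> in \<open>\<gg>\<close> the
  derivation of the polynomial ring along \<open>x \<mapsto> X x\<close> maps \<open>I\<close> to itself. First, the solution of
  \<open>z g' = C g\<close> with \<open>g(0) = 1\<close> and \<open>C\<close> in \<open>z \<gg>[[z]]\<close> is a point of \<open>G\<close>
  (\<open>fps_ode_satisfies_ideal\<close>). Secondly, \<open>D\<close> lies in \<open>\<gg>\<close> and \<open>z\<^sup>-\<^sup>D\<close> in \<open>G(K)\<close>; this is Chevalley's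
  theory of replicas, obtained here from the first fact (\<open>replica_satisfies_ideal\<close>): the relations
  in \<open>I\<close> hold for \<open>exp(t X)\<close>, whose entries are exponential sums, and since the exponentials
  \<open>exp(c t)\<close> are linearly independent over \<open>k[t]\<close>, the relations persist when \<open>exp(c t)\<close> is replaced
  by any other character of the additive group, such as \<open>1 + \<epsilon> f c\<close> or a power of \<open>z\<close>.
\<close>

section \<open>Matrices and generalised eigenspaces\<close>

lemma matrix_mult_nth: "(A ** B) $ i $ j = (\<Sum>l\<in>UNIV. A $ i $ l * B $ l $ j)"
  by (simp add: matrix_matrix_mult_def)

lemma mat_nth: "mat c $ i $ j = (if i = j then c else 0)"
  by (simp add: mat_def)

lemma matrix_add_rdistrib:
  "(A + B) ** C = A ** C + B ** (C :: 'a::semiring_1^'n^'m)"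
  by (vector matrix_matrix_mult_def sum.distrib[symmetric] distrib_right)

lemma matrix_diff_ldistrib:
  "A ** (B - C) = A ** B - A ** (C :: 'a::ring_1^'n^'m)"
  by (vector matrix_matrix_mult_def sum_subtractf[symmetric] right_diff_distrib)

lemma matrix_diff_rdistrib:
  "(A - B) ** C = A ** C - B ** (C :: 'a::ring_1^'n^'m)"
  by (vector matrix_matrix_mult_def sum_subtractf[symmetric] left_diff_distrib)

lemma matrix_minus_left: "(- A) ** B = - (A ** (B :: 'a::ring_1^'n^'m))"
  by (vector matrix_matrix_mult_def sum_negf[symmetric])

lemma matrix_minus_right: "A ** (- B) = - (A ** (B :: 'a::ring_1^'n^'m))"
  by (vector matrix_matrix_mult_def sum_negf[symmetric])

lemmas matrix_distribs = matrix_add_ldistrib matrix_add_rdistrib matrix_diff_ldistrib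
  matrix_diff_rdistrib matrix_minus_left matrix_minus_right

lemma matrix_sum_ldistrib: "A ** sum f S = (\<Sum>i\<in>S. A ** (f i :: 'a::ring_1^'n^'m))"
  by (induction S rule: infinite_finite_induct) (simp_all add: matrix_add_ldistrib)

lemma matrix_sum_rdistrib: "sum f S ** A = (\<Sum>i\<in>S. (f i :: 'a::ring_1^'n^'m) ** A)"
  by (induction S rule: infinite_finite_induct) (simp_all add: matrix_add_rdistrib)

lemma sum_matrix_nth: "sum f S $ i $ j = (\<Sum>x\<in>S. f x $ i $ j)"
  by (induction S rule: infinite_finite_induct) simp_all

definition scale_mat :: "'a::times \<Rightarrow> 'a^'n^'m \<Rightarrow> 'a^'n^'m" (infixr \<open>*m\<close> 75) where
  "c *m A = map_matrix ((*) c) A"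

lemma scale_mat_nth [simp]: "(c *m A) $ i $ j = c * A $ i $ j"
  by (simp add: scale_mat_def)

lemma mat_mult_left: "mat c ** A = c *m (A :: 'a::semiring_1^'n^'m)"
  by (simp add: vec_eq_iff matrix_mult_nth mat_nth if_distrib if_distribR sum.delta cong: if_cong)

lemma mat_mult_right: "A ** mat c = c *m (A :: 'a::comm_ring_1^'n^'m)"
  by (simp add: vec_eq_iff matrix_mult_nth mat_nth if_distrib if_distribR sum.delta' mult.commute
      cong: if_cong)

lemma scale_mat_mult_left: "(c *m A) ** B = c *m (A ** (B :: 'a::comm_ring_1^'n^'m))"
  by (simp add: vec_eq_iff matrix_mult_nth sum_distrib_left mult.assoc)

lemma scale_mat_mult_right: "A ** (c *m B) = c *m (A ** (B :: 'a::comm_ring_1^'n^'m))"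
  by (simp add: vec_eq_iff matrix_mult_nth sum_distrib_left mult.left_commute)

lemma scale_mat_scale_mat: "c *m d *m A = (c * d) *m (A :: 'a::comm_ring_1^'n^'m)"
  by (simp add: vec_eq_iff mult.assoc)

lemma scale_mat_mat: "c *m mat d = (mat (c * d) :: 'a::comm_ring_1^'n^'n)"
  by (simp add: vec_eq_iff mat_nth)

lemma scale_mat_right_distribs:
  "c *m (A + B) = c *m A + c *m (B :: 'a::comm_ring_1^'n^'m)"
  "c *m (A - B) = c *m A - c *m (B :: 'a::comm_ring_1^'n^'m)"
  "c *m (- A) = - (c *m (A :: 'a::comm_ring_1^'n^'m))"
  by (simp_all add: vec_eq_iff algebra_simps)

lemma scale_mat_left_distribs:
  "(c + d) *m A = c *m A + d *m (A :: 'a::comm_ring_1^'n^'m)"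
  "(c - d) *m A = c *m A - d *m (A :: 'a::comm_ring_1^'n^'m)"
  "(- c) *m A = - (c *m (A :: 'a::comm_ring_1^'n^'m))"
  by (simp_all add: vec_eq_iff algebra_simps)

lemma scale_mat_simps [simp]:
  "0 *m A = (0 :: 'a::comm_ring_1^'n^'m)"
  "1 *m A = (A :: 'a::comm_ring_1^'n^'m)"
  "c *m 0 = (0 :: 'a::comm_ring_1^'n^'m)"
  by (simp_all add: vec_eq_iff)

lemma scale_mat_sum: "c *m sum f S = (\<Sum>i\<in>S. c *m (f i :: 'a::comm_ring_1^'n^'m))"
  by (simp add: vec_eq_iff sum_matrix_nth sum_distrib_left)

lemmas scale_mat_mult = mat_mult_left mat_mult_right scale_mat_mult_left scale_mat_mult_right
  scale_mat_scale_mat scale_mat_mat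

lemmas mat_alg = matrix_distribs scale_mat_mult scale_mat_right_distribs scale_mat_left_distribs

lemma mat_add: "mat (c + d) = (mat c + mat d :: 'a::semiring_1^'n^'n)"
  by (simp add: vec_eq_iff mat_nth)

lemma mat_minus: "mat (- c) = (- mat c :: 'a::ring_1^'n^'n)"
  by (simp add: vec_eq_iff mat_nth)

lemma scale_mat_eq_0_iff: "c *m A = (0 :: 'a::idom^'n^'m) \<longleftrightarrow> c = 0 \<or> A = 0"
  by (auto simp: vec_eq_iff)

primrec matpow :: "'a::semiring_1^'n^'n \<Rightarrow> nat \<Rightarrow> 'a^'n^'n" where
  "matpow A 0 = mat 1"
| "matpow A (Suc e) = A ** matpow A e"

lemma matpow_commute:
  assumes "A ** B = B ** A" shows "matpow A e ** B = B ** matpow A e"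
proof (induction e)
  case (Suc e)
  have "matpow A (Suc e) ** B = A ** (matpow A e ** B)"
    by (simp add: matrix_mul_assoc)
  also have "\<dots> = (A ** B) ** matpow A e" by (simp add: Suc matrix_mul_assoc)
  also have "\<dots> = B ** matpow A (Suc e)" by (simp add: assms matrix_mul_assoc)
  finally show ?case .
qed simp

lemma matpow_add: "matpow A (d + e) = matpow A d ** matpow A e"
  by (induction d) (simp_all add: matrix_mul_assoc)

lemma matpow_kill_mono:
  assumes "matpow A d ** Z = 0" "d \<le> e" shows "matpow A e ** Z = (0 :: 'a::semiring_1^'m^'n)"
proof -
  have "matpow A e = matpow A (e - d) ** matpow A d"
    using assms(2) by (metis le_add_diff_inverse2 matpow_add)
  then show ?thesis by (simp add: matrix_mul_assoc[symmetric] assms(1))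
qed

lemma matpow_eigen:
  assumes "A ** W = c *m (W :: 'a::comm_ring_1^'n^'n)"
  shows "matpow (A - mat d) e ** W = ((c - d) ^ e) *m W"
proof (induction e)
  case (Suc e)
  have "matpow (A - mat d) (Suc e) ** W = (A - mat d) ** (((c - d) ^ e) *m W)"
    using Suc by (simp add: matrix_mul_assoc[symmetric])
  also have "\<dots> = ((c - d) ^ e) *m ((c - d) *m W)"
    by (simp add: mat_alg assms)
  also have "\<dots> = ((c - d) ^ Suc e) *m W"
    by (simp add: scale_mat_mult mult.commute)
  finally show ?case .
qed simp

text \<open>The last nonzero term of the sequence \<open>Z, (A - c) Z, (A - c)\<^sup>2 Z, \<dots>\<close> consists of eigenvectors.
  A matrix \<open>Z\<close> stands here for the tuple of its columns, so that no vectors are needed.\<close>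

lemma eigenvector_of_generalised:
  fixes A Z :: "'a::comm_ring_1^'n^'n"
  assumes "matpow (A - mat c) e ** Z = 0" "Z \<noteq> 0"
  obtains i where "matpow (A - mat c) i ** Z \<noteq> 0"
    "A ** (matpow (A - mat c) i ** Z) = c *m (matpow (A - mat c) i ** Z)"
proof -
  define i where "i = (LEAST e. matpow (A - mat c) e ** Z = 0)"
  have i: "matpow (A - mat c) i ** Z = 0"
    unfolding i_def by (rule LeastI) (rule assms(1))
  then obtain j where j: "i = Suc j" using assms(2) by (cases i) auto
  have ne: "matpow (A - mat c) j ** Z \<noteq> 0"
    using not_less_Least[of j "\<lambda>e. matpow (A - mat c) e ** Z = 0"] j i_def by auto
  have "(A - mat c) ** (matpow (A - mat c) j ** Z) = 0"
    using i j by (simp add: matrix_mul_assoc)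
  then show ?thesis using that[OF ne] by (simp add: mat_alg)
qed

lemma generalised_eigenspaces_disjoint:
  fixes A Z :: "'a::field^'n^'n"
  assumes "matpow (A - mat c) d ** Z = 0" "matpow (A - mat c') e ** Z = 0" "c \<noteq> c'"
  shows "Z = 0"
proof (rule ccontr)
  assume "Z \<noteq> 0"
  then obtain i where W: "matpow (A - mat c) i ** Z \<noteq> 0"
    "A ** (matpow (A - mat c) i ** Z) = c *m (matpow (A - mat c) i ** Z)"
    using eigenvector_of_generalised assms(1) by blast
  let ?W = "matpow (A - mat c) i ** Z"
  have comm: "(A - mat c') ** matpow (A - mat c) i = matpow (A - mat c) i ** (A - mat c')"
    by (rule matpow_commute[symmetric]) (simp add: mat_alg mult.commute)
  have "matpow (A - mat c') e ** ?W = matpow (A - mat c) i ** (matpow (A - mat c') e ** Z)"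
    by (simp add: matrix_mul_assoc matpow_commute[OF comm])
  then have "((c - c') ^ e) *m ?W = 0"
    using assms(2) matpow_eigen[OF W(2)] by simp
  then show False using scale_mat_eq_0_iff W(1) assms(3) by (metis eq_iff_diff_eq_0 power_not_zero)
qed

text \<open>This finiteness is used twice: for the powers of a matrix it provides an annihilating
  polynomial, and for the iterates of an operator on matrices it provides Fitting's decomposition.\<close>

lemma matrix_sequence_dependent:
  fixes s :: "nat \<Rightarrow> 'k::field^'n^'n"
  obtains a K where "\<exists>i\<le>K. a i \<noteq> 0" "(\<Sum>i\<le>K. (a i) *m s i) = 0"
proof -
  define v :: "nat \<Rightarrow> 'k^('n \<times> 'n)" where "v i = (\<chi> p. s i $ fst p $ snd p)" for i
  define K where "K = CARD('n \<times> 'n)"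
  show ?thesis
  proof (cases "inj_on v {..K}")
    case True
    then have "card (v ` {..K}) = Suc K" by (simp add: card_image)
    then have "vec.dependent (v ` {..K})"
      using vec.independent_bound_general[of "v ` {..K}"] vec.dim_subset_UNIV[of "v ` {..K}"]
      by (auto simp: K_def vec.dimension_def card_cart_basis)
    then obtain u where u: "\<exists>x\<in>v ` {..K}. u x \<noteq> 0" "(\<Sum>x\<in>v ` {..K}. u x *s x) = 0"
      by (auto simp: vec.dependent_finite)
    have "(\<Sum>i\<le>K. u (v i) *s v i) = 0"
      using u(2) sum.reindex[OF True, of "\<lambda>x. u x *s x"] by (simp add: o_def)
    then have *: "(\<Sum>i\<le>K. u (v i) *s v i) $ (p, q) = 0" for p q by simp
    have "(\<Sum>i\<le>K. (u (v i)) *m s i) = 0"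
      using * by (simp add: vec_eq_iff sum_matrix_nth scale_mat_nth) (simp add: v_def)
    then show ?thesis using that[of K "\<lambda>i. u (v i)"] u(1) by auto
  next
    case False
    then obtain i j where ij: "i \<le> K" "j \<le> K" "i \<noteq> j" "v i = v j"
      by (auto simp: inj_on_def)
    have "s i = s j" using ij(4) by (simp add: v_def vec_eq_iff)
    then have "(\<Sum>l\<le>K. (if l = i then 1 else if l = j then -1 else 0) *m s l)
        = (\<Sum>l\<le>K. (if l = i then s i else 0) + (if l = j then - s i else 0))"
      using ij(3) by (intro sum.cong) (auto simp: vec_eq_iff)
    also have "\<dots> = 0" using ij by (simp add: sum.distrib)
    finally show ?thesis
      using that[of K "\<lambda>l. if l = i then 1 else if l = j then -1 else 0"] ij(1) by force
  qed
qed

text \<open>Horner's rule, as \<open>**\<close> is not the multiplication of a ring class.\<close>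

definition poly_mat :: "'a::comm_ring_1^'n^'n \<Rightarrow> 'a poly \<Rightarrow> 'a^'n^'n" where
  "poly_mat A p = fold_coeffs (\<lambda>a M. mat a + A ** M) p 0"

lemma poly_mat_0 [simp]: "poly_mat A 0 = 0"
  by (simp add: poly_mat_def)

lemma poly_mat_pCons: "poly_mat A (pCons a p) = mat a + A ** poly_mat A p"
  by (cases "p = 0 \<and> a = 0") (auto simp: poly_mat_def)

lemma poly_mat_add: "poly_mat A (p + q) = poly_mat A p + poly_mat A q"
  by (induction p q rule: poly_induct2) (simp_all add: poly_mat_pCons mat_add matrix_distribs)

lemma poly_mat_smult: "poly_mat A (smult c p) = c *m poly_mat A p"
  by (induction p) (simp_all add: poly_mat_pCons mat_alg)

lemma poly_mat_mult: "poly_mat A (p * q) = poly_mat A p ** poly_mat A q"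
  by (induction p)
    (simp_all add: poly_mat_pCons poly_mat_add poly_mat_smult mat_alg matrix_mul_assoc)

lemma poly_mat_1 [simp]: "poly_mat A 1 = mat 1"
  by (simp add: one_pCons poly_mat_pCons)

lemma poly_mat_monom: "poly_mat A (monom c i) = c *m matpow A i"
  by (induction i) (simp_all add: monom_0 monom_Suc poly_mat_pCons scale_mat_mult)

lemma poly_mat_sum: "poly_mat A (sum f S) = (\<Sum>i\<in>S. poly_mat A (f i))"
  by (induction S rule: infinite_finite_induct) (simp_all add: poly_mat_add)

lemma poly_mat_linear_power: "poly_mat A ([:- c, 1:] ^ e) = matpow (A - mat c) e"
  proof (induction e)
  case (Suc e)
  have "poly_mat A [:- c, 1:] = A - mat c" by (simp add: poly_mat_pCons mat_minus)
  then show ?case by (simp only: power_Suc poly_mat_mult Suc matpow.simps)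
qed simp

lemma poly_mat_comm: "A ** poly_mat A p = poly_mat A p ** A"
  by (induction p) (simp_all add: poly_mat_pCons mat_alg matrix_mul_assoc)

text \<open>As \<open>q = b + (x - c) r\<close> with \<open>b = q(c) \<noteq> 0\<close>, the power \<open>((c - x) r)\<^sup>e\<close> is congruent to the unit
  \<open>b\<^sup>e\<close> modulo \<open>q\<close>.\<close>

lemma bezout_linear_power:
  fixes q :: "'a::field poly"
  assumes "poly q c \<noteq> 0"
  obtains u v where "u * [:- c, 1:] ^ e + v * q = 1"
proof -
  define b where "b = poly q c"
  have "[:- c, 1:] dvd q - [:b:]" by (simp add: poly_eq_0_iff_dvd[symmetric] b_def)
  then obtain r where r: "q - [:b:] = [:- c, 1:] * r" by (auto elim: dvdE)
  have "q dvd [:b:] ^ e - (- ([:- c, 1:] * r)) ^ e"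
  proof -
    have "[:b:] - (- ([:- c, 1:] * r)) = q" using r by (simp add: algebra_simps)
    then show ?thesis by (simp only: power_diff_sumr2 dvd_triv_left)
  qed
  then obtain w where w: "[:b:] ^ e - (- ([:- c, 1:] * r)) ^ e = q * w" by (auto elim: dvdE)
  have b0: "b ^ e \<noteq> 0" using assms b_def by simp
  have "[:b ^ e:] = (- r) ^ e * [:- c, 1:] ^ e + w * q"
  proof -
    have "- ([:- c, 1:] * r) = (- r) * [:- c, 1:]" by (simp only: mult_minus_left mult.commute)
    then have "(- ([:- c, 1:] * r)) ^ e = (- r) ^ e * [:- c, 1:] ^ e"
      by (simp only: power_mult_distrib)
    moreover have "[:b:] ^ e = (- ([:- c, 1:] * r)) ^ e + q * w" using w by (metis diff_add_cancel add.commute)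
    ultimately show ?thesis by (simp only: poly_const_pow mult.commute)
  qed
  then have "smult (inverse (b ^ e)) [:b ^ e:]
      = smult (inverse (b ^ e)) ((- r) ^ e) * [:- c, 1:] ^ e + smult (inverse (b ^ e)) w * q"
    by (simp add: smult_add_right)
  then show ?thesis
    using that[of "smult (inverse (b ^ e)) ((- r) ^ e)" "smult (inverse (b ^ e)) w"] b0
    by (simp add: one_pCons)
qed

text \<open>Splitting off one root of \<open>q\<close> at a time gives the primary decomposition of the space killed by
  \<open>q(A)\<close>. The parts are values of polynomials in \<open>A\<close>, so they commute with \<open>A\<close>.\<close>

lemma primary_decomposition:
  fixes A Z :: "'a::alg_closed_field^'n^'n"
  assumes "q \<noteq> 0" "poly_mat A q ** Z = 0"
  shows "\<exists>r. Z = (\<Sum>c | poly q c = 0. poly_mat A (r c) ** Z) \<and>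
    (\<forall>c. \<exists>e. matpow (A - mat c) e ** (poly_mat A (r c) ** Z) = 0)"
  using assms
proof (induction "degree q" arbitrary: q Z rule: less_induct)
  case less
  show ?case
  proof (cases "degree q = 0")
    case True
    then obtain b where b: "q = [:b:]" using degree_eq_zeroE by blast
    then have "b \<noteq> 0" "b *m Z = 0" using less.prems by (auto simp: poly_mat_pCons mat_alg)
    then have "Z = 0" by (simp add: scale_mat_eq_0_iff)
    then show ?thesis by auto
  next
    case False
    then obtain c where c: "poly q c = 0" using alg_closed_imp_poly_has_root by blast
    obtain p where p: "q = [:- c, 1:] ^ Polynomial.order c q * p" "\<not> [:- c, 1:] dvd p"
      using order_decomp[OF less.prems(1)] by blast
    define e where "e = Polynomial.order c q"
    have e: "e > 0" using c less.prems(1) order_root by (auto simp: e_def)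
    have pc: "poly p c \<noteq> 0" using p(2) by (simp add: poly_eq_0_iff_dvd)
    have p0: "p \<noteq> 0" using pc by auto
    have "degree q = e + degree p"
      using p(1) p0 by (metis degree_linear_power degree_mult_eq e_def mult_zero_left less.prems(1))
    then have deg: "degree p < degree q" using e by simp
    obtain u v where uv: "u * [:- c, 1:] ^ e + v * p = 1" using bezout_linear_power pc by blast
    define Z1 where "Z1 = poly_mat A (v * p) ** Z"
    define Z2 where "Z2 = poly_mat A (u * [:- c, 1:] ^ e) ** Z"
    have Z: "Z = Z2 + Z1"
      by (simp add: Z1_def Z2_def matrix_add_rdistrib[symmetric] poly_mat_add[symmetric] uv)
    have kill1: "matpow (A - mat c) e ** Z1 = 0"
    proof -
      have "[:- c, 1:] ^ e * (v * p) = v * q" by (subst p(1)) (simp add: e_def mult_ac)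
      then have "matpow (A - mat c) e ** Z1 = poly_mat A (v * q) ** Z"
        by (simp only: Z1_def poly_mat_linear_power[symmetric] matrix_mul_assoc
            poly_mat_mult[symmetric])
      then show ?thesis by (simp add: poly_mat_mult matrix_mul_assoc[symmetric] less.prems(2))
    qed
    have "poly_mat A p ** Z2 = poly_mat A (u * q) ** Z"
    proof -
      have "p * (u * [:- c, 1:] ^ e) = u * q" by (subst p(1)) (simp add: e_def mult_ac)
      then show ?thesis unfolding Z2_def
        by (simp only: matrix_mul_assoc poly_mat_mult[symmetric])
    qed
    then have "poly_mat A p ** Z2 = 0"
      by (simp add: poly_mat_mult matrix_mul_assoc[symmetric] less.prems(2))
    then obtain r where r: "Z2 = (\<Sum>d | poly p d = 0. poly_mat A (r d) ** Z2)"
      "\<And>d. \<exists>e. matpow (A - mat d) e ** (poly_mat A (r d) ** Z2) = 0"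
      using less.hyps[OF deg p0] by blast
    define r' where "r' d = (if d = c then v * p else r d * (u * [:- c, 1:] ^ e))" for d
    have roots: "{d. poly q d = 0} = insert c {d. poly p d = 0}"
    proof -
      have "poly q d = 0 \<longleftrightarrow> d = c \<or> poly p d = 0" for d
        using e by (subst p(1)) (auto simp: e_def[symmetric])
      then show ?thesis by auto
    qed
    have r'c: "poly_mat A (r' c) ** Z = Z1" by (simp add: r'_def Z1_def)
    have r'd: "poly_mat A (r' d) ** Z = poly_mat A (r d) ** Z2" if "d \<noteq> c" for d
      using that by (simp add: r'_def Z2_def poly_mat_mult matrix_mul_assoc)
    have "(\<Sum>d | poly q d = 0. poly_mat A (r' d) ** Z)
        = Z1 + (\<Sum>d | poly p d = 0. poly_mat A (r' d) ** Z)"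
      unfolding roots using pc poly_roots_finite[OF p0] by (simp add: r'c)
    also have "(\<Sum>d | poly p d = 0. poly_mat A (r' d) ** Z) = Z2"
      using pc by (subst r(1)) (intro sum.cong, auto intro!: r'd)
    finally have "Z = (\<Sum>d | poly q d = 0. poly_mat A (r' d) ** Z)"
      using Z by (simp add: add.commute)
    moreover have "\<exists>e. matpow (A - mat d) e ** (poly_mat A (r' d) ** Z) = 0" for d
      using kill1 r(2)[of d] r'c r'd[of d] by (cases "d = c") auto
    ultimately show ?thesis by blast
  qed
qed

lemma annihilating_polynomial:
  fixes A :: "'a::field^'n^'n"
  obtains q where "q \<noteq> 0" "poly_mat A q = 0"
proof -
  obtain a K where a: "\<exists>i\<le>K. a i \<noteq> 0" "(\<Sum>i\<le>K. (a i) *m matpow A i) = 0"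
    by (rule matrix_sequence_dependent[of "matpow A"])
  define q where "q = (\<Sum>i\<le>K. monom (a i) i)"
  have coeff: "coeff q i = a i" if "i \<le> K" for i
    using that by (simp add: q_def coeff_sum coeff_monom)
  obtain i where "i \<le> K" "a i \<noteq> 0" using a(1) by blast
  then have "q \<noteq> 0" using coeff[of i] by (metis coeff_0)
  moreover have "poly_mat A q = 0" using a(2) by (simp add: q_def poly_mat_sum poly_mat_monom)
  ultimately show ?thesis by (rule that)
qed

text \<open>The columns of \<open>W\<close> are eigenvectors or zero.\<close>

definition mat_eigenvalue :: "'a::comm_ring_1^'n^'n \<Rightarrow> 'a \<Rightarrow> bool" where
  "mat_eigenvalue A c \<longleftrightarrow> (\<exists>W :: 'a^'n^'n. W \<noteq> 0 \<and> A ** W = c *m W)"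

lemma finite_eigenvalues:
  fixes A :: "'a::field^'n^'n"
  shows "finite {c. mat_eigenvalue A c}"
proof -
  obtain q where q: "q \<noteq> 0" "poly_mat A q = 0" by (rule annihilating_polynomial)
  have "poly_mat A p ** W = (poly p c) *m W" if "A ** W = c *m W" for p c W
  proof (induction p)
    case (pCons a p)
    have "poly_mat A (pCons a p) ** W = a *m W + A ** (poly_mat A p ** W)"
      by (simp add: poly_mat_pCons mat_alg matrix_mul_assoc)
    also have "\<dots> = a *m W + (poly p c) *m (c *m W)"
      by (simp add: pCons scale_mat_mult that)
    finally show ?case by (simp add: mat_alg mult.commute)
  qed simp
  from this[of _ _ q] have "{c. mat_eigenvalue A c} \<subseteq> {c. poly q c = 0}"
    unfolding mat_eigenvalue_def q(2) by (auto simp: scale_mat_eq_0_iff)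
  then show ?thesis using poly_roots_finite[OF q(1)] finite_subset by blast
qed

text \<open>\<open>P c\<close> is the part of the identity matrix in the primary decomposition. The product of two
  different projections vanishes since its columns lie in two generalised eigenspaces.\<close>

lemma spectral_projections:
  fixes A :: "'a::alg_closed_field^'n^'n"
  obtains P where "mat 1 = (\<Sum>c | mat_eigenvalue A c. P c)"
    "\<And>c. \<exists>e. matpow (A - mat c) e ** P c = 0"
    "\<And>c. A ** P c = P c ** A"
    "\<And>c d. c \<noteq> d \<Longrightarrow> P c ** P d = 0"
    "\<And>c. P c \<noteq> 0 \<Longrightarrow> mat_eigenvalue A c"
proof -
  obtain q where q: "q \<noteq> 0" "poly_mat A q = 0" by (rule annihilating_polynomial)
  from primary_decomposition[OF q(1), of A "mat 1"] q(2)
  obtain r where r: "mat 1 = (\<Sum>c | poly q c = 0. poly_mat A (r c))"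
    "\<And>c. \<exists>e. matpow (A - mat c) e ** poly_mat A (r c) = 0"
    by auto
  define P where "P c = (if poly q c = 0 then poly_mat A (r c) else 0)" for c
  have kill: "\<exists>e. matpow (A - mat c) e ** P c = 0" for c
    using r(2) by (auto simp: P_def)
  have comm: "A ** P c = P c ** A" for c
    by (simp add: P_def poly_mat_comm)
  have eig: "mat_eigenvalue A c" if nz: "P c \<noteq> 0" for c
  proof -
    obtain e where "matpow (A - mat c) e ** P c = 0" using kill by blast
    then obtain i where "matpow (A - mat c) i ** P c \<noteq> 0"
      "A ** (matpow (A - mat c) i ** P c) = c *m (matpow (A - mat c) i ** P c)"
      using nz by (rule eigenvector_of_generalised)
    then show ?thesis unfolding mat_eigenvalue_def by blast
  qed
  have "P c ** P d = 0" if "c \<noteq> d" for c d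
  proof -
    obtain i j where ij: "matpow (A - mat c) i ** P c = 0" "matpow (A - mat d) j ** P d = 0"
      using kill by blast
    have "(A - mat d) ** P c = P c ** (A - mat d)" by (simp add: mat_alg comm)
    then have "matpow (A - mat d) j ** (P c ** P d) = P c ** (matpow (A - mat d) j ** P d)"
      by (metis matrix_mul_assoc matpow_commute)
    then have "matpow (A - mat d) j ** (P c ** P d) = 0" using ij by simp
    moreover have "matpow (A - mat c) i ** (P c ** P d) = 0" using ij by (simp add: matrix_mul_assoc)
    ultimately show ?thesis using generalised_eigenspaces_disjoint that by blast
  qed
  moreover have "mat 1 = (\<Sum>c | mat_eigenvalue A c. P c)"
  proof -
    have "mat 1 = (\<Sum>c | poly q c = 0. P c)" using r(1) by (simp add: P_def)
    also have "\<dots> = (\<Sum>c | poly q c = 0 \<and> mat_eigenvalue A c. P c)"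
      by (rule sum.mono_neutral_right) (use poly_roots_finite[OF q(1)] eig in auto)
    also have "\<dots> = (\<Sum>c | mat_eigenvalue A c. P c)"
      by (rule sum.mono_neutral_left) (use finite_eigenvalues[of A] in \<open>auto simp: P_def\<close>)
    finally show ?thesis .
  qed
  ultimately show ?thesis using that kill comm eig by blast
qed

section \<open>Ring homomorphisms and evaluation of polynomials\<close>

definition ring_map :: "('a::comm_ring_1 \<Rightarrow> 'b::comm_ring_1) \<Rightarrow> bool" where
  "ring_map \<theta> \<longleftrightarrow> (\<forall>x y. \<theta> (x + y) = \<theta> x + \<theta> y) \<and> (\<forall>x y. \<theta> (x * y) = \<theta> x * \<theta> y) \<and> \<theta> 1 = 1"

lemma ring_mapI:
  assumes "\<And>x y. \<theta> (x + y) = \<theta> x + \<theta> y" "\<And>x y. \<theta> (x * y) = \<theta> x * \<theta> y" "\<theta> 1 = 1"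
  shows "ring_map \<theta>"
  using assms by (simp add: ring_map_def)

lemma
  assumes "ring_map \<theta>"
  shows ring_map_add: "\<theta> (x + y) = \<theta> x + \<theta> y"
    and ring_map_mult: "\<theta> (x * y) = \<theta> x * \<theta> y"
    and ring_map_1: "\<theta> 1 = 1"
    and ring_map_0: "\<theta> 0 = 0"
    and ring_map_minus: "\<theta> (- x) = - \<theta> x"
    and ring_map_diff: "\<theta> (x - y) = \<theta> x - \<theta> y"
    and ring_map_power: "\<theta> (x ^ n) = \<theta> x ^ n"
    and ring_map_sum: "\<theta> (sum f S) = (\<Sum>i\<in>S. \<theta> (f i))"
    and ring_map_prod: "\<theta> (prod f S) = (\<Prod>i\<in>S. \<theta> (f i))"
proof -
  show add: "\<theta> (x + y) = \<theta> x + \<theta> y" for x y using assms by (simp add: ring_map_def)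
  show mult: "\<theta> (x * y) = \<theta> x * \<theta> y" for x y using assms by (simp add: ring_map_def)
  show one: "\<theta> 1 = 1" using assms by (simp add: ring_map_def)
  show zero: "\<theta> 0 = 0" using add[of 0 0] by simp
  show minus: "\<theta> (- x) = - \<theta> x" for x
    using add[of x "- x"] zero by (simp add: eq_neg_iff_add_eq_0 add.commute)
  show "\<theta> (x - y) = \<theta> x - \<theta> y" using add[of x "- y"] minus[of y] by simp
  show "\<theta> (x ^ n) = \<theta> x ^ n" by (induction n) (simp_all add: one mult)
  show "\<theta> (sum f S) = (\<Sum>i\<in>S. \<theta> (f i))"
    by (induction S rule: infinite_finite_induct) (simp_all add: zero add)
  show "\<theta> (prod f S) = (\<Prod>i\<in>S. \<theta> (f i))"
    by (induction S rule: infinite_finite_induct) (simp_all add: one mult)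
qed

lemma ring_map_comp: "ring_map \<theta> \<Longrightarrow> ring_map \<phi> \<Longrightarrow> ring_map (\<lambda>x. \<theta> (\<phi> x))"
  by (simp add: ring_map_def)

lemma ring_map_id: "ring_map (\<lambda>x. x)"
  by (simp add: ring_map_def)

lemma map_matrix_mult:
  assumes "ring_map \<theta>"
  shows "map_matrix \<theta> (A ** B) = map_matrix \<theta> A ** map_matrix \<theta> B"
  by (simp add: vec_eq_iff matrix_mult_nth ring_map_sum[OF assms] ring_map_mult[OF assms])

lemma map_matrix_mat: "\<theta> 0 = 0 \<Longrightarrow> map_matrix \<theta> (mat c) = mat (\<theta> c)"
  by (simp add: vec_eq_iff mat_nth)

lemma map_matrix_map_matrix: "map_matrix \<theta> (map_matrix \<phi> A) = map_matrix (\<lambda>x. \<theta> (\<phi> x)) A"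
  by (simp add: vec_eq_iff)

lemma map_matrix_sum:
  assumes "ring_map \<theta>"
  shows "map_matrix \<theta> (sum f S) = (\<Sum>i\<in>S. map_matrix \<theta> (f i))"
  by (simp add: vec_eq_iff sum_matrix_nth ring_map_sum[OF assms])

lemma map_matrix_add:
  assumes "ring_map \<theta>"
  shows "map_matrix \<theta> (A + B) = map_matrix \<theta> A + map_matrix \<theta> B"
  by (simp add: vec_eq_iff ring_map_add[OF assms])

lemma map_matrix_diff:
  assumes "ring_map \<theta>"
  shows "map_matrix \<theta> (A - B) = map_matrix \<theta> A - map_matrix \<theta> B"
  by (simp add: vec_eq_iff ring_map_diff[OF assms])

lemma invertible_map_matrix:
  assumes "ring_map \<theta>" "invertible A"
  shows "invertible (map_matrix \<theta> A)"
proof -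
  obtain B where "A ** B = mat 1" "B ** A = mat 1" using assms(2) by (auto simp: invertible_def)
  then have "map_matrix \<theta> A ** map_matrix \<theta> B = mat 1" "map_matrix \<theta> B ** map_matrix \<theta> A = mat 1"
    by (simp_all add: map_matrix_mult[OF assms(1), symmetric] map_matrix_mat ring_map_0[OF assms(1)]
        ring_map_1[OF assms(1)])
  then show ?thesis by (auto simp: invertible_def)
qed

lemma eval_entries_ring_map:
  assumes "ring_map \<theta>"
  shows "\<theta> (eval_entries \<phi> g p) = eval_entries (\<lambda>x. \<theta> (\<phi> x)) (map_matrix \<theta> g) p"
  by (simp add: eval_entries_def ring_map_sum[OF assms] ring_map_mult[OF assms]
      ring_map_prod[OF assms] ring_map_power[OF assms] case_prod_beta)

text \<open>The homomorphism out of the monoid ring \<open>R[M]\<close> that is determined by its restrictions to \<open>R\<close>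
  and to \<open>M\<close>. It serves for polynomial rings and for rings of exponential sums alike.\<close>

definition monoid_ring_lift ::
  "('m \<Rightarrow> 's::comm_ring_1) \<Rightarrow> ('r::zero \<Rightarrow> 's) \<Rightarrow> ('m \<Rightarrow>\<^sub>0 'r) \<Rightarrow> 's" where
  "monoid_ring_lift \<kappa> \<psi> x = (\<Sum>a\<in>Poly_Mapping.keys x. \<psi> (Poly_Mapping.lookup x a) * \<kappa> a)"

lemma monoid_ring_lift_superset:
  assumes "finite S" "Poly_Mapping.keys x \<subseteq> S" "\<psi> 0 = 0"
  shows "monoid_ring_lift \<kappa> \<psi> x = (\<Sum>a\<in>S. \<psi> (Poly_Mapping.lookup x a) * \<kappa> a)"
  unfolding monoid_ring_lift_def
  by (rule sum.mono_neutral_left) (use assms in \<open>auto simp: in_keys_iff\<close>)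

lemma poly_mapping_sum_single:
  "(\<Sum>a\<in>Poly_Mapping.keys x. Poly_Mapping.single a (Poly_Mapping.lookup x a)) = x"
  by (rule poly_mapping_eqI)
    (simp add: lookup_sum lookup_single when_def in_keys_iff sum.delta')

lemma monoid_ring_lift_single:
  assumes "\<psi> 0 = 0"
  shows "monoid_ring_lift \<kappa> \<psi> (Poly_Mapping.single a r) = \<psi> r * \<kappa> a"
  by (simp add: monoid_ring_lift_def assms)

lemma ring_map_monoid_ring_lift:
  fixes \<kappa> :: "'m::comm_monoid_add \<Rightarrow> 's::comm_ring_1" and \<psi> :: "'r::comm_ring_1 \<Rightarrow> 's"
  assumes "ring_map \<psi>" "\<kappa> 0 = 1" "\<And>a b. \<kappa> (a + b) = \<kappa> a * \<kappa> b"
  shows "ring_map (monoid_ring_lift \<kappa> \<psi>)"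
proof -
  let ?\<Theta> = "monoid_ring_lift \<kappa> \<psi>"
  note [simp] = ring_map_0[OF assms(1)]
  have add: "?\<Theta> (x + y) = ?\<Theta> x + ?\<Theta> y" for x y
  proof -
    let ?S = "Poly_Mapping.keys x \<union> Poly_Mapping.keys y"
    have sub: "Poly_Mapping.keys (x + y) \<subseteq> ?S" by (rule Poly_Mapping.keys_add)
    show ?thesis
      by (subst (1 2 3) monoid_ring_lift_superset[of ?S])
        (use sub in \<open>auto simp: lookup_add ring_map_add[OF assms(1)] distrib_right sum.distrib\<close>)
  qed
  have zero: "?\<Theta> 0 = 0" by (simp add: monoid_ring_lift_def)
  have sum: "?\<Theta> (sum f S) = (\<Sum>i\<in>S. ?\<Theta> (f i))" for f :: "'x \<Rightarrow> _" and S
    by (induction S rule: infinite_finite_induct) (simp_all add: zero add)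
  have "?\<Theta> (x * y) = ?\<Theta> x * ?\<Theta> y" for x y
  proof -
    let ?s = "\<lambda>x a. Poly_Mapping.single a (Poly_Mapping.lookup x a)"
    have "x * y = (\<Sum>a\<in>Poly_Mapping.keys x. ?s x a) * (\<Sum>b\<in>Poly_Mapping.keys y. ?s y b)"
      by (simp add: poly_mapping_sum_single)
    also have "\<dots> = (\<Sum>a\<in>Poly_Mapping.keys x. \<Sum>b\<in>Poly_Mapping.keys y. ?s x a * ?s y b)"
      by (simp add: sum_product)
    finally have "?\<Theta> (x * y)
        = (\<Sum>a\<in>Poly_Mapping.keys x. \<Sum>b\<in>Poly_Mapping.keys y. ?\<Theta> (?s x a) * ?\<Theta> (?s y b))"
      by (simp add: sum mult_single monoid_ring_lift_single assms(3) ring_map_mult[OF assms(1)]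
          mult_ac)
    also have "\<dots> = ?\<Theta> x * ?\<Theta> y"
      by (simp add: sum_product[symmetric] sum[symmetric] poly_mapping_sum_single)
    finally show ?thesis .
  qed
  moreover have "?\<Theta> 1 = 1"
    by (simp add: single_one[symmetric] monoid_ring_lift_single ring_map_1[OF assms(1)] assms(2)
        del: single_one)
  ultimately show ?thesis using add by (intro ring_mapI)
qed

abbreviation poly_const :: "'k::comm_ring_1 \<Rightarrow> ('k, 'n) entry_poly" where
  "poly_const c \<equiv> Poly_Mapping.single 0 c"

definition poly_var :: "'n \<Rightarrow> 'n \<Rightarrow> ('k::comm_ring_1, 'n) entry_poly" where
  "poly_var i j = Poly_Mapping.single (Poly_Mapping.single (i, j) 1) 1"

definition generic_matrix :: "('k::comm_ring_1, 'n) entry_poly^'n^'n" where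
  "generic_matrix = (\<chi> i j. poly_var i j)"

lemma ring_map_poly_const: "ring_map poly_const"
  by (rule ring_mapI) (simp_all add: single_add mult_single)

lemma eval_entries_eq_monoid_ring_lift:
  fixes g :: "'r::comm_ring_1^'n^'n"
  shows "eval_entries \<phi> g = monoid_ring_lift (\<lambda>m. \<Prod>p\<in>UNIV. (g $ fst p $ snd p) ^ Poly_Mapping.lookup m p) \<phi>"
proof -
  have "(\<Prod>(i, j)\<in>Poly_Mapping.keys m. (g $ i $ j) ^ Poly_Mapping.lookup m (i, j))
      = (\<Prod>p\<in>UNIV. (g $ fst p $ snd p) ^ Poly_Mapping.lookup m p)" for m :: "('n \<times> 'n) \<Rightarrow>\<^sub>0 nat"
    by (rule prod.mono_neutral_cong_left) (auto simp: in_keys_iff)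
  then show ?thesis by (simp add: fun_eq_iff eval_entries_def monoid_ring_lift_def)
qed

lemma ring_map_eval_entries: "ring_map \<phi> \<Longrightarrow> ring_map (eval_entries \<phi> g)"
  unfolding eval_entries_eq_monoid_ring_lift
  by (rule ring_map_monoid_ring_lift) (simp_all add: lookup_add power_add prod.distrib)

lemma eval_entries_const: "ring_map \<phi> \<Longrightarrow> eval_entries \<phi> g (poly_const c) = \<phi> c"
  by (simp add: eval_entries_eq_monoid_ring_lift monoid_ring_lift_single ring_map_0)

lemma eval_entries_var:
  assumes "ring_map \<phi>"
  shows "eval_entries \<phi> g (poly_var i j) = g $ i $ j"
proof -
  have "eval_entries \<phi> g (poly_var i j)
      = (\<Prod>p\<in>UNIV. (g $ fst p $ snd p) ^ Poly_Mapping.lookup (Poly_Mapping.single (i, j) 1) p)"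
    by (simp add: eval_entries_eq_monoid_ring_lift poly_var_def monoid_ring_lift_single
        ring_map_0[OF assms] ring_map_1[OF assms])
  also have "\<dots> = (\<Prod>p\<in>UNIV. if p = (i, j) then g $ i $ j else 1)"
    by (rule prod.cong) (auto simp: lookup_single when_def)
  finally show ?thesis by simp
qed

lemma eval_entries_generic_matrix:
  "ring_map \<phi> \<Longrightarrow> map_matrix (eval_entries \<phi> g) generic_matrix = g"
  by (simp add: vec_eq_iff generic_matrix_def eval_entries_var)

lemma poly_var_power: "poly_var i j ^ e = Poly_Mapping.single (Poly_Mapping.single (i, j) e) 1"
  by (induction e) (simp_all add: poly_var_def mult_single single_add[symmetric])

lemma prod_single_1:
  "(\<Prod>x\<in>S. Poly_Mapping.single (f x) 1) = Poly_Mapping.single (\<Sum>x\<in>S. f x) (1 :: 'a::comm_ring_1)"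
  by (induction S rule: infinite_finite_induct) (simp_all add: mult_single)

lemma eval_entries_generic:
  fixes p :: "('k::comm_ring_1, 'n::finite) entry_poly"
  shows "eval_entries poly_const generic_matrix p = p"
proof -
  have "(\<Prod>(i, j)\<in>Poly_Mapping.keys m. (generic_matrix $ i $ j) ^ Poly_Mapping.lookup m (i, j))
      = Poly_Mapping.single m (1 :: 'k)" for m :: "('n \<times> 'n) \<Rightarrow>\<^sub>0 nat"
  proof -
    have "(\<Prod>(i, j)\<in>Poly_Mapping.keys m. (generic_matrix $ i $ j) ^ Poly_Mapping.lookup m (i, j))
      = (\<Prod>x\<in>Poly_Mapping.keys m.
          Poly_Mapping.single (Poly_Mapping.single x (Poly_Mapping.lookup m x)) (1 :: 'k))"
      by (rule prod.cong) (auto simp: generic_matrix_def poly_var_power)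
    then show ?thesis by (simp add: prod_single_1 poly_mapping_sum_single)
  qed
  then have "eval_entries poly_const generic_matrix p
      = (\<Sum>m\<in>Poly_Mapping.keys p. poly_const (Poly_Mapping.lookup p m) * Poly_Mapping.single m 1)"
    by (simp add: eval_entries_def)
  then show ?thesis by (simp add: mult_single poly_mapping_sum_single)
qed

text \<open>Every polynomial is its own value at the generic matrix, and this value is a sum of products
  of constants and variables.\<close>

lemma entry_poly_induct [case_names const var add mult]:
  fixes p :: "('k::comm_ring_1, 'n::finite) entry_poly"
  assumes const: "\<And>c. P (poly_const c)" and var: "\<And>i j. P (poly_var i j)"
    and add: "\<And>p q. P p \<Longrightarrow> P q \<Longrightarrow> P (p + q)" and mult: "\<And>p q. P p \<Longrightarrow> P q \<Longrightarrow> P (p * q)"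
  shows "P p"
proof -
  have zero: "P 0" and one: "P 1" using const[of 0] const[of 1] by simp_all
  have sum: "P (sum f S)" if "\<And>x. x \<in> S \<Longrightarrow> P (f x)" for f :: "'x \<Rightarrow> _" and S
    using that by (induction S rule: infinite_finite_induct) (simp_all add: zero add)
  have prod: "P (prod f S)" if "\<And>x. x \<in> S \<Longrightarrow> P (f x)" for f :: "'x \<Rightarrow> _" and S
    using that by (induction S rule: infinite_finite_induct) (simp_all add: one mult)
  have power: "P (q ^ e)" if "P q" for q e
    using that by (induction e) (simp_all add: one mult)
  have "P (eval_entries poly_const generic_matrix p)"
    unfolding eval_entries_def
    by (intro sum mult const prod) (auto simp: generic_matrix_def intro!: power var)
  then show ?thesis by (simp add: eval_entries_generic)
qed

lemma eval_entries_substitute: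
  assumes "ring_map \<phi>"
  shows "eval_entries \<phi> g (eval_entries poly_const M p) = eval_entries \<phi> (map_matrix (eval_entries \<phi> g) M) p"
  by (simp add: eval_entries_ring_map[OF ring_map_eval_entries[OF assms]] eval_entries_const[OF assms])

section \<open>The ideal of a group and its Lie algebra\<close>

text \<open>For invertible \<open>g\<close> this is membership in \<open>points \<phi> G\<close>. The condition on the ideal alone is
  preserved by all ring homomorphisms and reflected by injective ones.\<close>

definition satisfies_ideal ::
  "('k::field \<Rightarrow> 'r::comm_ring_1) \<Rightarrow> ('k^'n^'n) set \<Rightarrow> 'r^'n^'n \<Rightarrow> bool" where
  "satisfies_ideal \<phi> G g \<longleftrightarrow> (\<forall>p\<in>vanishing_ideal G. eval_entries \<phi> g p = 0)"

lemma points_iff: "g \<in> points \<phi> G \<longleftrightarrow> invertible g \<and> satisfies_ideal \<phi> G g"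
  by (simp add: points_def GL_def satisfies_ideal_def)

lemma satisfies_ideal_ring_map:
  assumes "ring_map \<theta>" "satisfies_ideal \<phi> G g"
  shows "satisfies_ideal (\<lambda>x. \<theta> (\<phi> x)) G (map_matrix \<theta> g)"
  using assms(2) by (simp add: satisfies_ideal_def eval_entries_ring_map[OF assms(1), symmetric]
      ring_map_0[OF assms(1)])

lemma satisfies_ideal_ring_map_inj:
  assumes "ring_map \<theta>" "\<And>x. \<theta> x = 0 \<Longrightarrow> x = 0" "satisfies_ideal (\<lambda>x. \<theta> (\<phi> x)) G (map_matrix \<theta> g)"
  shows "satisfies_ideal \<phi> G g"
  using assms(2,3) by (simp add: satisfies_ideal_def eval_entries_ring_map[OF assms(1), symmetric])

lemma satisfies_ideal_mem: "g \<in> G \<Longrightarrow> satisfies_ideal (\<lambda>a. a) G g"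
  by (simp add: satisfies_ideal_def vanishing_ideal_def)

definition translate_left :: "'k::comm_ring_1^'n^'n \<Rightarrow> ('k, 'n) entry_poly \<Rightarrow> ('k, 'n) entry_poly" where
  "translate_left x p = eval_entries poly_const (map_matrix poly_const x ** generic_matrix) p"

definition translate_right :: "'k::comm_ring_1^'n^'n \<Rightarrow> ('k, 'n) entry_poly \<Rightarrow> ('k, 'n) entry_poly" where
  "translate_right x p = eval_entries poly_const (generic_matrix ** map_matrix poly_const x) p"

lemma map_eval_entries_const:
  "ring_map \<phi> \<Longrightarrow> map_matrix (eval_entries \<phi> g) (map_matrix poly_const x) = map_matrix \<phi> x"
  by (simp add: vec_eq_iff eval_entries_const)

lemma eval_translate_left:
  assumes "ring_map \<phi>"
  shows "eval_entries \<phi> y (translate_left x p) = eval_entries \<phi> (map_matrix \<phi> x ** y) p"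
  by (simp add: translate_left_def eval_entries_substitute[OF assms]
      map_matrix_mult[OF ring_map_eval_entries[OF assms]] map_eval_entries_const[OF assms]
      eval_entries_generic_matrix[OF assms])

lemma eval_translate_right:
  assumes "ring_map \<phi>"
  shows "eval_entries \<phi> y (translate_right x p) = eval_entries \<phi> (y ** map_matrix \<phi> x) p"
  by (simp add: translate_right_def eval_entries_substitute[OF assms]
      map_matrix_mult[OF ring_map_eval_entries[OF assms]] map_eval_entries_const[OF assms]
      eval_entries_generic_matrix[OF assms])

lemma map_matrix_ident: "map_matrix (\<lambda>x. x) A = A"
  by (simp add: vec_eq_iff)

lemma
  assumes "subgroup G GL" "x \<in> G" "p \<in> vanishing_ideal G"
  shows translate_left_ideal: "translate_left x p \<in> vanishing_ideal G"
    and translate_right_ideal: "translate_right x p \<in> vanishing_ideal G"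
  using assms subgroup.m_closed[OF assms(1)]
  by (auto simp: vanishing_ideal_def eval_translate_left[OF ring_map_id] map_matrix_ident
      eval_translate_right[OF ring_map_id] GL_def)

lemma satisfies_ideal_translate:
  assumes "subgroup G GL" "ring_map \<phi>" "x \<in> G" "satisfies_ideal \<phi> G y"
  shows "satisfies_ideal \<phi> G (map_matrix \<phi> x ** y)" "satisfies_ideal \<phi> G (y ** map_matrix \<phi> x)"
  using assms(4) translate_left_ideal[OF assms(1,3)] translate_right_ideal[OF assms(1,3)]
  by (auto simp: satisfies_ideal_def eval_translate_left[OF assms(2), symmetric]
      eval_translate_right[OF assms(2), symmetric])

subsection \<open>Dual numbers and derivations\<close>

lemma dual_sel_simps [simp]:
  "dual_std (x + y) = dual_std x + dual_std y" "dual_eps (x + y) = dual_eps x + dual_eps y"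
  "dual_std (x * y) = dual_std x * dual_std y"
  "dual_eps (x * y) = dual_std x * dual_eps y + dual_eps x * dual_std y"
  "dual_std 0 = 0" "dual_eps 0 = 0" "dual_std 1 = 1" "dual_eps 1 = 0"
  by (simp_all add: plus_dual_def times_dual_def zero_dual_def one_dual_def)

lemma ring_map_dual_std: "ring_map dual_std"
  by (rule ring_mapI) simp_all

lemma ring_map_dual_const: "ring_map \<phi> \<Longrightarrow> ring_map (\<lambda>x. dual_const (\<phi> x))"
  by (simp add: ring_map_def plus_dual_def times_dual_def one_dual_def)

lemma dual_eps_sum: "dual_eps (sum f S) = (\<Sum>x\<in>S. dual_eps (f x))"
  by (induction S rule: infinite_finite_induct) simp_all

lemma ring_map_dualI:
  assumes "ring_map \<theta>" "\<And>x y. d (x + y) = d x + d y" "\<And>x y. d (x * y) = \<theta> x * d y + d x * \<theta> y"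
  shows "ring_map (\<lambda>x. Dual (\<theta> x) (d x))"
proof -
  have "d 1 = 0" using assms(3)[of 1 1] ring_map_1[OF assms(1)] by simp
  then show ?thesis using assms
    by (simp add: ring_map_def plus_dual_def times_dual_def one_dual_def)
qed

definition dual_matrix :: "'a^'n^'n \<Rightarrow> 'a^'n^'n \<Rightarrow> 'a dual^'n^'n" where
  "dual_matrix A B = (\<chi> i j. Dual (A $ i $ j) (B $ i $ j))"

lemma dual_matrix_nth [simp]: "dual_matrix A B $ i $ j = Dual (A $ i $ j) (B $ i $ j)"
  by (simp add: dual_matrix_def)

lemma dual_matrix_mult:
  "dual_matrix A B ** dual_matrix A' B' = dual_matrix (A ** A') (A ** B' + B ** (A' :: 'a::comm_ring_1^'n^'n))"
  by (simp add: vec_eq_iff matrix_mult_nth dual.expand ring_map_sum[OF ring_map_dual_std]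
      dual_eps_sum sum.distrib)

lemma eval_dual_std:
  "dual_std (eval_entries (\<lambda>c. dual_const (\<phi> c)) (dual_matrix x y) p) = eval_entries \<phi> x p"
proof -
  have "map_matrix dual_std (dual_matrix x y) = x" by (simp add: vec_eq_iff)
  then show ?thesis by (simp add: eval_entries_ring_map[OF ring_map_dual_std])
qed

text \<open>The derivation of the polynomial ring that sends the generic matrix \<open>x\<close> to \<open>E\<^sub>i\<^sub>l x\<close>, where
  \<open>E\<^sub>i\<^sub>l\<close> is a matrix unit.\<close>

definition unit_derivation :: "'n \<Rightarrow> 'n \<Rightarrow> ('k::comm_ring_1, 'n::finite) entry_poly \<Rightarrow> ('k, 'n) entry_poly" where
  "unit_derivation i l p = dual_eps (eval_entries (\<lambda>c. dual_const (poly_const c))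
     (dual_matrix generic_matrix (\<chi> a b. if a = i then poly_var l b else 0)) p)"

lemma
  fixes p q :: "('k::comm_ring_1, 'n::finite) entry_poly"
  shows unit_derivation_const: "unit_derivation i l (poly_const c :: ('k, 'n) entry_poly) = 0"
    and unit_derivation_var: "unit_derivation i l (poly_var a b :: ('k, 'n) entry_poly)
          = (if a = i then poly_var l b else 0)"
    and unit_derivation_add: "unit_derivation i l (p + q) = unit_derivation i l p + unit_derivation i l q"
    and unit_derivation_mult: "unit_derivation i l (p * q)
          = p * unit_derivation i l q + unit_derivation i l p * q"
proof -
  note hom = ring_map_dual_const[OF ring_map_poly_const]
  note ev = ring_map_eval_entries[OF hom]
  show "unit_derivation i l (poly_const c :: ('k, 'n) entry_poly) = 0"
    by (simp add: unit_derivation_def eval_entries_const[OF hom])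
  show "unit_derivation i l (poly_var a b :: ('k, 'n) entry_poly) = (if a = i then poly_var l b else 0)"
    by (simp add: unit_derivation_def eval_entries_var[OF hom])
  show "unit_derivation i l (p + q) = unit_derivation i l p + unit_derivation i l q"
    by (simp add: unit_derivation_def ring_map_add[OF ev])
  show "unit_derivation i l (p * q) = p * unit_derivation i l q + unit_derivation i l p * q"
    by (simp add: unit_derivation_def ring_map_mult[OF ev] eval_dual_std eval_entries_generic)
qed

text \<open>Both sides are derivations in \<open>p\<close> that agree on the variables. On the right-hand side \<open>C\<close> enters
  only as a coefficient, which allows \<open>C\<close> to have entries in an extension of the base field.\<close>

lemma eval_dual_eps:
  fixes p :: "('k::comm_ring_1, 'n::finite) entry_poly"
  assumes "ring_map \<phi>"
  shows "dual_eps (eval_entries (\<lambda>c. dual_const (\<phi> c)) (dual_matrix x (C ** x)) p)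
    = (\<Sum>i\<in>UNIV. \<Sum>l\<in>UNIV. C $ i $ l * eval_entries \<phi> x (unit_derivation i l p))"
proof (induction p rule: entry_poly_induct)
  case (const c)
  show ?case
    by (simp add: unit_derivation_const eval_entries_const[OF ring_map_dual_const[OF assms]]
        ring_map_0[OF ring_map_eval_entries[OF assms]])
next
  case (var a b)
  have "(\<Sum>i\<in>UNIV. \<Sum>l\<in>UNIV. C $ i $ l * eval_entries \<phi> x (unit_derivation i l (poly_var a b)))
      = (\<Sum>i\<in>UNIV. if i = a then (\<Sum>l\<in>UNIV. C $ i $ l * x $ l $ b) else 0)"
    by (rule sum.cong) (auto simp: unit_derivation_var eval_entries_var[OF assms]
        ring_map_0[OF ring_map_eval_entries[OF assms]])
  then show ?case
    by (simp add: eval_entries_var[OF ring_map_dual_const[OF assms]] matrix_mult_nth)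
next
  case (add p q)
  then show ?case
    by (simp add: ring_map_add[OF ring_map_eval_entries[OF ring_map_dual_const[OF assms]]]
        unit_derivation_add ring_map_add[OF ring_map_eval_entries[OF assms]] distrib_left sum.distrib)
next
  case (mult p q)
  then show ?case
    by (simp add: ring_map_mult[OF ring_map_eval_entries[OF ring_map_dual_const[OF assms]]]
        unit_derivation_mult ring_map_add[OF ring_map_eval_entries[OF assms]] eval_dual_std
        ring_map_mult[OF ring_map_eval_entries[OF assms]] distrib_left sum.distrib sum_distrib_left
        sum_distrib_right mult_ac)
qed

text \<open>The derivative along the right-invariant vector field \<open>x \<mapsto> X x\<close>.\<close>

definition matrix_derivation ::
  "'k::comm_ring_1^'n^'n \<Rightarrow> ('k, 'n::finite) entry_poly \<Rightarrow> ('k, 'n) entry_poly" where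
  "matrix_derivation X p = (\<Sum>i\<in>UNIV. \<Sum>l\<in>UNIV. poly_const (X $ i $ l) * unit_derivation i l p)"

lemma eval_matrix_derivation:
  assumes "ring_map \<phi>"
  shows "eval_entries \<phi> x (matrix_derivation X p)
    = (\<Sum>i\<in>UNIV. \<Sum>l\<in>UNIV. \<phi> (X $ i $ l) * eval_entries \<phi> x (unit_derivation i l p))"
  by (simp add: matrix_derivation_def ring_map_sum[OF ring_map_eval_entries[OF assms]]
      ring_map_mult[OF ring_map_eval_entries[OF assms]] eval_entries_const[OF assms])

lemma eval_matrix_derivation_dual:
  assumes "ring_map \<phi>"
  shows "eval_entries \<phi> x (matrix_derivation X p)
    = dual_eps (eval_entries (\<lambda>c. dual_const (\<phi> c)) (dual_matrix x (map_matrix \<phi> X ** x)) p)"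
  by (simp add: eval_matrix_derivation[OF assms] eval_dual_eps[OF assms])

lemma matrix_derivation_const: "matrix_derivation X (poly_const c) = 0"
  by (simp add: matrix_derivation_def unit_derivation_const)

lemma matrix_derivation_var:
  "matrix_derivation X (poly_var a b) = (\<Sum>l\<in>UNIV. poly_const (X $ a $ l) * poly_var l b)"
proof -
  have "matrix_derivation X (poly_var a b)
      = (\<Sum>i\<in>UNIV. if i = a then (\<Sum>l\<in>UNIV. poly_const (X $ i $ l) * poly_var l b) else 0)"
    unfolding matrix_derivation_def by (rule sum.cong) (auto simp: unit_derivation_var)
  then show ?thesis by simp
qed

lemma matrix_derivation_add:
  "matrix_derivation X (p + q) = matrix_derivation X p + matrix_derivation X q"
  by (simp add: matrix_derivation_def unit_derivation_add distrib_left sum.distrib)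

lemma matrix_derivation_mult:
  "matrix_derivation X (p * q) = p * matrix_derivation X q + matrix_derivation X p * q"
  by (simp add: matrix_derivation_def unit_derivation_mult distrib_left sum.distrib sum_distrib_left
        sum_distrib_right mult_ac)

lemma matrix_derivation_sum:
  "matrix_derivation X (sum f S) = (\<Sum>i\<in>S. matrix_derivation X (f i))"
proof -
  have "matrix_derivation X 0 = 0" using matrix_derivation_const[of X 0] by simp
  then show ?thesis
    by (induction S rule: infinite_finite_induct) (simp_all add: matrix_derivation_add)
qed

lemma matrix_derivation_linear:
  "matrix_derivation (X + Y) p = matrix_derivation X p + matrix_derivation Y p"
  "matrix_derivation (X - Y) p = matrix_derivation X p - matrix_derivation Y p"
  "matrix_derivation (c *m X) p = poly_const c * matrix_derivation X p"
proof -
  show "matrix_derivation (X + Y) p = matrix_derivation X p + matrix_derivation Y p"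
    by (simp add: matrix_derivation_def single_add distrib_right sum.distrib)
  show "matrix_derivation (X - Y) p = matrix_derivation X p - matrix_derivation Y p"
    by (simp add: matrix_derivation_def single_diff left_diff_distrib sum_subtractf)
  show "matrix_derivation (c *m X) p = poly_const c * matrix_derivation X p"
    by (simp add: matrix_derivation_def sum_distrib_left ring_map_mult[OF ring_map_poly_const]
        mult.assoc)
qed

lemma matrix_derivation_derivation_var:
  "matrix_derivation X (matrix_derivation Y (poly_var a b)) = matrix_derivation (Y ** X) (poly_var a b)"
proof -
  have "matrix_derivation X (matrix_derivation Y (poly_var a b))
      = (\<Sum>l\<in>UNIV. \<Sum>m\<in>UNIV. poly_const (Y $ a $ l * X $ l $ m) * poly_var m b)"
    by (simp add: matrix_derivation_var matrix_derivation_sum matrix_derivation_mult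
        matrix_derivation_const sum_distrib_left mult.assoc[symmetric]
        ring_map_mult[OF ring_map_poly_const])
  also have "\<dots> = (\<Sum>m\<in>UNIV. poly_const ((Y ** X) $ a $ m) * poly_var m b)"
    by (subst sum.swap)
      (simp add: matrix_mult_nth ring_map_sum[OF ring_map_poly_const] sum_distrib_right)
  finally show ?thesis by (simp add: matrix_derivation_var)
qed

text \<open>Both sides are derivations, and they agree on the variables.\<close>

lemma matrix_derivation_commutator:
  "matrix_derivation X (matrix_derivation Y p) - matrix_derivation Y (matrix_derivation X p)
    = matrix_derivation (Y ** X - X ** Y) p"
proof (induction p rule: entry_poly_induct)
  case (const c)
  have "matrix_derivation X 0 = 0" for X :: "'b^'a^'a" using matrix_derivation_const[of X 0] by simp
  then show ?case by (simp add: matrix_derivation_const)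
next
  case (var a b)
  show ?case by (simp add: matrix_derivation_derivation_var matrix_derivation_linear)
next
  case (add p q)
  then show ?case by (simp add: matrix_derivation_add algebra_simps)
next
  case (mult p q)
  show ?case
    unfolding matrix_derivation_mult[of "Y ** X - X ** Y"] mult.IH[symmetric]
    by (simp add: matrix_derivation_add matrix_derivation_mult algebra_simps)
qed

subsection \<open>The Lie algebra\<close>

lemma mat_1_mem: "subgroup G GL \<Longrightarrow> mat 1 \<in> G"
  using subgroup.one_closed[of G GL] by (simp add: GL_def)

lemma lie_algebra_iff_satisfies:
  "X \<in> lie_algebra G \<longleftrightarrow> satisfies_ideal dual_const G (dual_matrix (mat 1) X)"
proof -
  have one: "dual_matrix (mat 1) 0 = (mat 1 :: 'a dual^'b^'b)"
    by (simp add: vec_eq_iff mat_nth one_dual_def zero_dual_def)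
  have "dual_matrix (mat 1) X ** dual_matrix (mat 1) (- X) = mat 1"
    "dual_matrix (mat 1) (- X) ** dual_matrix (mat 1) X = mat 1"
    by (simp_all add: dual_matrix_mult one)
  then have "invertible (dual_matrix (mat 1) X)" by (auto simp: invertible_def)
  then show ?thesis by (simp add: lie_algebra_def points_iff dual_matrix_def)
qed

text \<open>At a point \<open>x\<close> of the group the derivative is the \<open>\<epsilon>\<close>-part of \<open>p((1 + \<epsilon>X) x)\<close>, and the right
  translate of \<open>p\<close> by \<open>x\<close> vanishes at \<open>1 + \<epsilon>X\<close>.\<close>

lemma matrix_derivation_ideal:
  assumes "subgroup G GL" "X \<in> lie_algebra G" "p \<in> vanishing_ideal G"
  shows "matrix_derivation X p \<in> vanishing_ideal G"
proof -
  have "eval_entries (\<lambda>a. a) x (matrix_derivation X p) = 0" if "x \<in> G" for x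
  proof -
    have x: "dual_matrix x (X ** x) = dual_matrix (mat 1) X ** map_matrix dual_const x"
    proof -
      have "map_matrix dual_const x = dual_matrix x 0" by (simp add: vec_eq_iff)
      then show ?thesis by (simp add: dual_matrix_mult)
    qed
    have "satisfies_ideal dual_const G (dual_matrix x (X ** x))"
      using satisfies_ideal_translate(2)[OF assms(1) ring_map_dual_const[OF ring_map_id] that]
        assms(2) x by (simp add: lie_algebra_iff_satisfies)
    then show ?thesis using assms(3)
      by (simp add: eval_matrix_derivation_dual[OF ring_map_id] map_matrix_ident satisfies_ideal_def)
  qed
  then show ?thesis by (simp add: vanishing_ideal_def)
qed

lemma lie_algebra_iff_derivation:
  assumes "subgroup G GL"
  shows "X \<in> lie_algebra G \<longleftrightarrow>
    (\<forall>p\<in>vanishing_ideal G. eval_entries (\<lambda>a. a) (mat 1) (matrix_derivation X p) = 0)"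
proof
  assume "X \<in> lie_algebra G"
  then show "\<forall>p\<in>vanishing_ideal G. eval_entries (\<lambda>a. a) (mat 1) (matrix_derivation X p) = 0"
    using matrix_derivation_ideal[OF assms] mat_1_mem[OF assms]
    by (auto simp: vanishing_ideal_def)
next
  assume *: "\<forall>p\<in>vanishing_ideal G. eval_entries (\<lambda>a. a) (mat 1) (matrix_derivation X p) = 0"
  have "eval_entries dual_const (dual_matrix (mat 1) X) p = 0" if "p \<in> vanishing_ideal G" for p
  proof (rule dual.expand, intro conjI)
    show "dual_std (eval_entries dual_const (dual_matrix (mat 1) X) p) = dual_std 0"
      using that mat_1_mem[OF assms] by (simp add: eval_dual_std vanishing_ideal_def)
    show "dual_eps (eval_entries dual_const (dual_matrix (mat 1) X) p) = dual_eps 0"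
      using * that eval_matrix_derivation_dual[OF ring_map_id, of "mat 1" X p]
      by (simp add: map_matrix_ident)
  qed
  then show "X \<in> lie_algebra G" by (simp add: lie_algebra_iff_satisfies satisfies_ideal_def)
qed

lemma
  fixes G :: "('k::field^'n^'n) set"
  assumes "subgroup G GL"
  shows lie_algebra_add: "X \<in> lie_algebra G \<Longrightarrow> Y \<in> lie_algebra G \<Longrightarrow> X + Y \<in> lie_algebra G"
    and lie_algebra_diff: "X \<in> lie_algebra G \<Longrightarrow> Y \<in> lie_algebra G \<Longrightarrow> X - Y \<in> lie_algebra G"
    and lie_algebra_scale: "X \<in> lie_algebra G \<Longrightarrow> c *m X \<in> lie_algebra G"
    and lie_algebra_0: "0 \<in> lie_algebra G"
    and lie_algebra_bracket: "X \<in> lie_algebra G \<Longrightarrow> Y \<in> lie_algebra G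
      \<Longrightarrow> X ** Y - Y ** X \<in> lie_algebra G"
proof -
  note ev = ring_map_eval_entries[OF ring_map_id]
  show "X + Y \<in> lie_algebra G" if "X \<in> lie_algebra G" "Y \<in> lie_algebra G"
    using that by (simp add: lie_algebra_iff_derivation[OF assms] matrix_derivation_linear ring_map_add[OF ev])
  show "X - Y \<in> lie_algebra G" if "X \<in> lie_algebra G" "Y \<in> lie_algebra G"
    using that by (simp add: lie_algebra_iff_derivation[OF assms] matrix_derivation_linear ring_map_diff[OF ev])
  show scale: "c *m X \<in> lie_algebra G" if "X \<in> lie_algebra G" for c X
    using that by (simp add: lie_algebra_iff_derivation[OF assms] matrix_derivation_linear ring_map_mult[OF ev])
  have "mat 1 \<in> G" by (rule mat_1_mem[OF assms])
  then have "satisfies_ideal dual_const G (map_matrix dual_const (mat 1))"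
    using satisfies_ideal_ring_map[OF ring_map_dual_const[OF ring_map_id] satisfies_ideal_mem] by blast
  moreover have "map_matrix dual_const (mat 1) = dual_matrix (mat 1) (0 :: 'k^'n^'n)"
    by (simp add: vec_eq_iff)
  ultimately show "0 \<in> lie_algebra G" by (simp add: lie_algebra_iff_satisfies)
  show "X ** Y - Y ** X \<in> lie_algebra G" if XY: "X \<in> lie_algebra G" "Y \<in> lie_algebra G"
  proof -
    have "eval_entries (\<lambda>a. a) (mat 1) (matrix_derivation (X ** Y - Y ** X) p) = 0"
      if p: "p \<in> vanishing_ideal G" for p
    proof -
      have "matrix_derivation Y (matrix_derivation X p) \<in> vanishing_ideal G"
        "matrix_derivation X (matrix_derivation Y p) \<in> vanishing_ideal G"
        using XY p by (simp_all add: matrix_derivation_ideal[OF assms])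
      then show ?thesis using \<open>mat 1 \<in> G\<close>
        by (simp add: matrix_derivation_commutator[symmetric] ring_map_diff[OF ev] vanishing_ideal_def)
    qed
    then show ?thesis by (simp add: lie_algebra_iff_derivation[OF assms])
  qed
qed

lemma lie_algebra_sum:
  assumes "subgroup G GL" "\<And>i. i \<in> S \<Longrightarrow> f i \<in> lie_algebra G"
  shows "sum f S \<in> lie_algebra G"
  using assms(2) by (induction S rule: infinite_finite_induct)
    (simp_all add: lie_algebra_0[OF assms(1)] lie_algebra_add[OF assms(1)])

section \<open>Points of the group over power series\<close>

abbreviation fps_coeff :: "nat \<Rightarrow> 'a fps^'n^'n \<Rightarrow> 'a^'n^'n" where
  "fps_coeff m A \<equiv> map_matrix (\<lambda>f. fps_nth f m) A"

lemma ring_map_fps_const: "ring_map fps_const"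
  by (rule ring_mapI) simp_all

lemma ring_map_fps_nth_0: "ring_map (\<lambda>f. fps_nth f 0)"
  by (rule ring_mapI) simp_all

lemma ring_map_fps_euler: "ring_map (\<lambda>f :: 'a::comm_ring_1 fps. Dual f (fps_X * fps_deriv f))"
  by (rule ring_map_dualI[OF ring_map_id]) (simp_all add: algebra_simps)

text \<open>For \<open>p\<close> in the ideal, the chain rule expresses \<open>z d/dz p(g)\<close> as \<open>\<Sum> z\<^sup>m (D\<^sub>m p)(g)\<close>, where \<open>D\<^sub>m\<close> is
  the derivation of the \<open>m\<close>-th coefficient of \<open>C\<close>. As \<open>C\<close> starts with \<open>m = 1\<close>, the coefficient of
  \<open>z\<^sup>N\<close> in \<open>p(g)\<close> is determined by lower coefficients of \<open>(D\<^sub>m p)(g)\<close>, and \<open>D\<^sub>m p\<close> is again in the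
  ideal. The constant term is \<open>p(1) = 0\<close>.\<close>

lemma fps_ode_satisfies_ideal:
  fixes g C :: "'k::field_char_0 fps^'n^'n"
  assumes G: "subgroup G GL"
    and C: "\<And>m. fps_coeff m C \<in> lie_algebra G" "fps_coeff 0 C = 0"
    and g: "fps_coeff 0 g = mat 1" "map_matrix (\<lambda>f. fps_X * fps_deriv f) g = C ** g"
  shows "satisfies_ideal fps_const G g"
proof -
  let ?ev = "eval_entries fps_const g"
  let ?\<theta> = "\<lambda>f. Dual f (fps_X * fps_deriv f)"
  have euler: "fps_X * fps_deriv (?ev p)
      = (\<Sum>i\<in>UNIV. \<Sum>l\<in>UNIV. C $ i $ l * ?ev (unit_derivation i l p))" for p
  proof -
    have "map_matrix ?\<theta> g = dual_matrix g (C ** g)"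
      by (simp add: vec_eq_iff g(2)[symmetric])
    moreover have "?\<theta> (?ev p) = eval_entries (\<lambda>c. ?\<theta> (fps_const c)) (map_matrix ?\<theta> g) p"
      by (rule eval_entries_ring_map[OF ring_map_fps_euler])
    ultimately have "?\<theta> (?ev p)
        = eval_entries (\<lambda>c. dual_const (fps_const c)) (dual_matrix g (C ** g)) p"
      by simp
    then have "fps_X * fps_deriv (?ev p)
        = dual_eps (eval_entries (\<lambda>c. dual_const (fps_const c)) (dual_matrix g (C ** g)) p)"
      by (metis dual.sel(2))
    then show ?thesis by (simp add: eval_dual_eps[OF ring_map_fps_const])
  qed
  have coeff: "of_nat N * fps_nth (?ev p) N
      = (\<Sum>m=0..N. fps_nth (?ev (matrix_derivation (fps_coeff m C) p)) (N - m))" for N p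
  proof -
    have "of_nat N * fps_nth (?ev p) N = fps_nth (fps_X * fps_deriv (?ev p)) N"
      by (cases N) simp_all
    also have "\<dots> = (\<Sum>i\<in>UNIV. \<Sum>l\<in>UNIV. \<Sum>m=0..N. fps_nth (C $ i $ l) m *
        fps_nth (?ev (unit_derivation i l p)) (N - m))"
      unfolding euler by (simp add: fps_sum_nth fps_mult_nth)
    also have "\<dots> = (\<Sum>i\<in>UNIV. \<Sum>m=0..N. \<Sum>l\<in>UNIV. fps_nth (C $ i $ l) m *
        fps_nth (?ev (unit_derivation i l p)) (N - m))"
      by (intro sum.cong refl sum.swap)
    also have "\<dots> = (\<Sum>m=0..N. \<Sum>i\<in>UNIV. \<Sum>l\<in>UNIV. fps_nth (C $ i $ l) m *
        fps_nth (?ev (unit_derivation i l p)) (N - m))"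
      by (rule sum.swap)
    also have "\<dots> = (\<Sum>m=0..N. fps_nth (?ev (matrix_derivation (fps_coeff m C) p)) (N - m))"
      by (simp add: eval_matrix_derivation[OF ring_map_fps_const] fps_sum_nth)
    finally show ?thesis .
  qed
  have "fps_nth (?ev p) N = 0" if "p \<in> vanishing_ideal G" for N p
    using that
  proof (induction N arbitrary: p rule: less_induct)
    case (less N)
    show ?case
    proof (cases "N = 0")
      case True
      have "fps_nth (?ev p) 0 = eval_entries (\<lambda>c. c) (mat 1) p"
        using eval_entries_ring_map[OF ring_map_fps_nth_0, of fps_const g p] g(1) by simp
      then show ?thesis using less.prems mat_1_mem[OF G] True by (simp add: vanishing_ideal_def)
    next
      case False
      have "fps_nth (?ev (matrix_derivation (fps_coeff m C) p)) (N - m) = 0" if "m \<le> N" for m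
      proof (cases "m = 0")
        case True
        have "matrix_derivation 0 p = 0" by (simp add: matrix_derivation_def)
        then show ?thesis
          using True C(2) by (simp add: ring_map_0[OF ring_map_eval_entries[OF ring_map_fps_const]])
      next
        case False
        then show ?thesis
          using less.IH[of "N - m"] matrix_derivation_ideal[OF G C(1) less.prems] that by simp
      qed
      then have "of_nat N * fps_nth (?ev p) N = 0" unfolding coeff by simp
      then show ?thesis using False by simp
    qed
  qed
  then show ?thesis by (simp add: satisfies_ideal_def fps_eq_iff)
qed

subsection \<open>Exponential sums\<close>

lemma exponentials_independent:
  fixes h :: "'m \<Rightarrow> 'k::field_char_0"
  assumes "inj h" "finite S" "(\<Sum>a\<in>S. fps_of_poly (q a) * fps_exp (h a)) = 0" "a \<in> S"
  shows "q a = 0"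
  using assms(2-4)
proof (induction S arbitrary: q a rule: finite_induct)
  case (insert b S)
  \<comment> \<open>The operator \<open>d/dt - h b\<close> lowers the degree of the coefficient of
    \<open>exp(h b t)\<close> and loses no other term.\<close>
  have base: "\<forall>a\<in>insert b S. r a = 0"
    if "(\<Sum>a\<in>insert b S. fps_of_poly (r a) * fps_exp (h a)) = 0" "r b = 0" for r
    using that insert.IH[of r] insert.hyps by auto
  have "\<forall>a\<in>insert b S. r a = 0"
    if "(\<Sum>a\<in>insert b S. fps_of_poly (r a) * fps_exp (h a)) = 0" for r
    using that
  proof (induction "degree (r b)" arbitrary: r rule: less_induct)
    case less
    define r' where "r' a = pderiv (r a) + smult (h a - h b) (r a)" for a
    have "(\<Sum>a\<in>insert b S. fps_of_poly (r' a) * fps_exp (h a))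
        = fps_deriv (\<Sum>a\<in>insert b S. fps_of_poly (r a) * fps_exp (h a))
          - fps_const (h b) * (\<Sum>a\<in>insert b S. fps_of_poly (r a) * fps_exp (h a))"
      unfolding fps_deriv_sum sum_distrib_left sum_subtractf[symmetric]
      by (rule sum.cong) (simp_all add: r'_def fps_of_poly_add fps_of_poly_smult fps_of_poly_pderiv
          algebra_simps fps_const_sub[symmetric] del: fps_const_sub)
    then have sum': "(\<Sum>a\<in>insert b S. fps_of_poly (r' a) * fps_exp (h a)) = 0"
      by (simp add: less.prems)
    have all': "\<forall>a\<in>insert b S. r' a = 0"
    proof (cases "degree (r b) = 0")
      case True
      then have "r' b = 0" by (simp add: r'_def pderiv_eq_0_iff)
      then show ?thesis using base[OF sum'] by blast
    next
      case False
      then have "degree (r' b) < degree (r b)" by (simp add: r'_def degree_pderiv)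
      then show ?thesis using less.hyps sum' by blast
    qed
    have S: "r a = 0" if "a \<in> S" for a
    proof (rule ccontr)
      assume nz: "r a \<noteq> 0"
      have "h a \<noteq> h b" using that insert.hyps assms(1) by (auto dest: injD)
      have "coeff (r' a) (degree (r a)) = (h a - h b) * lead_coeff (r a)"
        by (simp add: r'_def coeff_pderiv coeff_eq_0)
      then show False using all' that nz \<open>h a \<noteq> h b\<close> by simp
    qed
    have "fps_of_poly (r b) * fps_exp (h b) = 0"
      using less.prems insert.hyps S by simp
    then have "fps_of_poly (r b) = fps_of_poly 0" by simp
    then have "r b = 0" by (simp only: fps_of_poly_eq_iff)
    then show ?case using S by simp
  qed
  then show ?case using insert.prems by blast
qed simp

text \<open>Let \<open>P a\<close> be the component of the identity on which \<open>X\<close> has the generalised eigenvalue \<open>h a\<close>. Then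
  \<open>exp(t X)\<close> is the sum of the \<open>exp(h a t) Q a\<close>, where \<open>Q a\<close> has polynomial entries in \<open>t\<close> and value
  \<open>P a\<close> at \<open>t = 0\<close>. It is the image of a matrix \<open>\<Gamma>\<close> over the monoid ring \<open>k[t][M]\<close> under an injective
  homomorphism \<open>\<Phi>\<close>, so that the relations satisfied by \<open>exp(t X)\<close> already hold for \<open>\<Gamma>\<close>. They are
  inherited by the image of \<open>\<Gamma>\<close> under the homomorphism \<open>\<Psi>\<close> that puts \<open>t = 0\<close> and sends \<open>a\<close> to
  \<open>\<kappa> a\<close>.\<close>

lemma replica_satisfies_ideal:
  fixes X :: "'k::field_char_0^'n^'n" and h :: "'m::comm_monoid_add \<Rightarrow> 'k"
    and \<phi> :: "'k \<Rightarrow> 'r::comm_ring_1"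
  assumes G: "subgroup G GL" and X: "X \<in> lie_algebra G"
    and h: "inj h" "h 0 = 0" "\<And>a b. h (a + b) = h a + h b"
    and S: "finite S" "mat 1 = (\<Sum>a\<in>S. P a)"
    and P: "\<And>a. a \<in> S \<Longrightarrow> \<exists>e. matpow (X - mat (h a)) e ** P a = 0"
    and \<phi>: "ring_map \<phi>" and \<kappa>: "\<kappa> 0 = 1" "\<And>a b. \<kappa> (a + b) = \<kappa> a * \<kappa> b"
  shows "satisfies_ideal \<phi> G (\<Sum>a\<in>S. \<kappa> a *m map_matrix \<phi> (P a))"
proof -
  define N where "N a l = matpow (X - mat (h a)) l ** P a" for a l
  define ex where "ex a = (SOME e. N a e = 0)" for a
  have ex: "N a (ex a) = 0" if "a \<in> S" for a
    unfolding ex_def by (rule someI_ex) (use P[OF that] N_def in auto)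
  \<comment> \<open>\<open>Q a = exp(t (X - h a)) P a\<close>, a polynomial since a power of \<open>X - h a\<close> kills \<open>P a\<close>.\<close>
  define Q :: "'m \<Rightarrow> 'k poly^'n^'n" where
    "Q a = (\<chi> i j. \<Sum>l<ex a. monom (N a l $ i $ j / fact l) l)" for a
  have coeff_Q: "coeff (Q a $ i $ j) l = N a l $ i $ j / fact l" if "a \<in> S" for a i j l
  proof (cases "l < ex a")
    case False
    then have "N a l = 0"
      using ex[OF that] matpow_kill_mono[of "X - mat (h a)" "ex a" "P a" l] by (simp add: N_def)
    then show ?thesis using False by (simp add: Q_def coeff_sum coeff_monom)
  qed (simp add: Q_def coeff_sum coeff_monom)
  have ode: "pderiv (Q a $ i $ j) + smult (h a) (Q a $ i $ j)
      = (\<Sum>l\<in>UNIV. smult (X $ i $ l) (Q a $ l $ j))" if "a \<in> S" for a i j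
  proof (rule poly_eqI)
    fix l
    have "N a (Suc l) = X ** N a l - h a *m N a l"
      by (simp add: N_def matrix_mul_assoc[symmetric]) (simp add: mat_alg)
    then have "N a (Suc l) $ i $ j + h a * N a l $ i $ j = (\<Sum>m\<in>UNIV. X $ i $ m * N a l $ m $ j)"
      by (simp add: matrix_mult_nth)
    then have "(N a (Suc l) $ i $ j + h a * N a l $ i $ j) / fact l
        = (\<Sum>m\<in>UNIV. X $ i $ m * (N a l $ m $ j / fact l))"
      by (simp add: sum_divide_distrib)
    then show "coeff (pderiv (Q a $ i $ j) + smult (h a) (Q a $ i $ j)) l
        = coeff (\<Sum>l\<in>UNIV. smult (X $ i $ l) (Q a $ l $ j)) l"
      using that by (simp add: coeff_pderiv coeff_sum coeff_Q add_divide_distrib fact_Suc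
          del: of_nat_Suc)
  qed

  define \<Gamma> :: "('m \<Rightarrow>\<^sub>0 'k poly)^'n^'n" where
    "\<Gamma> = (\<Sum>a\<in>S. map_matrix (Poly_Mapping.single a) (Q a))"
  define \<Phi> :: "('m \<Rightarrow>\<^sub>0 'k poly) \<Rightarrow> 'k fps" where
    "\<Phi> = monoid_ring_lift (\<lambda>a. fps_exp (h a)) fps_of_poly"
  define \<Psi> :: "('m \<Rightarrow>\<^sub>0 'k poly) \<Rightarrow> 'r" where
    "\<Psi> = monoid_ring_lift \<kappa> (\<lambda>q. \<phi> (coeff q 0))"
  have hom_poly: "ring_map fps_of_poly"
    by (rule ring_mapI) (simp_all add: fps_of_poly_add fps_of_poly_mult)
  have hom0: "ring_map (\<lambda>q :: 'k poly. coeff q 0)"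
    by (rule ring_mapI) (simp_all add: coeff_mult_0)
  have \<Phi>: "ring_map \<Phi>" unfolding \<Phi>_def
    by (rule ring_map_monoid_ring_lift[OF hom_poly]) (simp_all add: h fps_exp_add_mult)
  have \<Psi>: "ring_map \<Psi>" unfolding \<Psi>_def
    by (rule ring_map_monoid_ring_lift[OF ring_map_comp[OF \<phi> hom0]]) (simp_all add: \<kappa>)
  have \<Phi>_single: "\<Phi> (Poly_Mapping.single a q) = fps_of_poly q * fps_exp (h a)" for a q
    by (simp add: \<Phi>_def monoid_ring_lift_single)
  have \<Psi>_single: "\<Psi> (Poly_Mapping.single a q) = \<phi> (coeff q 0) * \<kappa> a" for a q
    by (simp add: \<Psi>_def monoid_ring_lift_single ring_map_0[OF \<phi>])
  have \<Phi>_inj: "x = 0" if "\<Phi> x = 0" for x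
  proof -
    have "poly_mapping.lookup x a = 0" if "a \<in> Poly_Mapping.keys x" for a
      using exponentials_independent[OF h(1) finite_keys _ that] \<open>\<Phi> x = 0\<close>
      by (simp add: \<Phi>_def monoid_ring_lift_def)
    then show ?thesis by (metis in_keys_iff poly_mapping_eqI lookup_zero)
  qed
  define g where "g = map_matrix \<Phi> \<Gamma>"
  have g_nth: "g $ i $ j = (\<Sum>a\<in>S. fps_of_poly (Q a $ i $ j) * fps_exp (h a))" for i j
    by (simp add: g_def \<Gamma>_def map_matrix_sum[OF \<Phi>] sum_matrix_nth \<Phi>_single ring_map_sum[OF \<Phi>])
  have N0: "N a 0 = P a" for a by (simp add: N_def)
  have "satisfies_ideal fps_const G g"
  proof (rule fps_ode_satisfies_ideal[OF G])
    let ?C = "fps_X *m map_matrix fps_const X"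
    have C: "fps_coeff m ?C = (if m = 1 then X else 0)" for m
      by (auto simp: vec_eq_iff)
    show "fps_coeff m ?C \<in> lie_algebra G" for m
      unfolding C by (simp add: X lie_algebra_0[OF G])
    show "fps_coeff 0 ?C = 0" by (simp add: C)
    show "fps_coeff 0 g = mat 1"
      by (simp add: vec_eq_iff g_nth fps_sum_nth coeff_Q N0 S(2) sum_matrix_nth)
    have "fps_deriv (g $ i $ j) = (map_matrix fps_const X ** g) $ i $ j" for i j
    proof -
      have "fps_deriv (g $ i $ j)
          = (\<Sum>a\<in>S. fps_of_poly (pderiv (Q a $ i $ j) + smult (h a) (Q a $ i $ j)) * fps_exp (h a))"
        unfolding g_nth fps_deriv_sum
        by (rule sum.cong) (simp_all add: fps_of_poly_add fps_of_poly_smult fps_of_poly_pderiv algebra_simps)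
      also have "\<dots> = (\<Sum>a\<in>S. \<Sum>l\<in>UNIV. fps_const (X $ i $ l) * (fps_of_poly (Q a $ l $ j) * fps_exp (h a)))"
        by (rule sum.cong) (simp_all add: ode fps_of_poly_sum fps_of_poly_smult sum_distrib_left
            sum_distrib_right mult_ac)
      also have "\<dots> = (map_matrix fps_const X ** g) $ i $ j"
        by (subst sum.swap) (simp add: matrix_mult_nth g_nth sum_distrib_left)
      finally show ?thesis .
    qed
    then show "map_matrix (\<lambda>f. fps_X * fps_deriv f) g = ?C ** g"
      by (simp add: vec_eq_iff scale_mat_mult_left)
  qed
  then have "satisfies_ideal (\<lambda>c. \<Phi> (Poly_Mapping.single 0 [:c:])) G (map_matrix \<Phi> \<Gamma>)"
    by (simp add: \<Phi>_single h fps_of_poly_const g_def)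
  then have "satisfies_ideal (\<lambda>c. Poly_Mapping.single 0 [:c:]) G \<Gamma>"
    by (rule satisfies_ideal_ring_map_inj[OF \<Phi>, rotated]) (rule \<Phi>_inj)
  then have "satisfies_ideal (\<lambda>c. \<Psi> (Poly_Mapping.single 0 [:c:])) G (map_matrix \<Psi> \<Gamma>)"
    by (rule satisfies_ideal_ring_map[OF \<Psi>])
  moreover have "(\<lambda>c. \<Psi> (Poly_Mapping.single 0 [:c:])) = \<phi>"
    by (simp add: \<Psi>_single \<kappa>)
  moreover have "map_matrix \<Psi> \<Gamma> = (\<Sum>a\<in>S. \<kappa> a *m map_matrix \<phi> (P a))"
    by (auto simp: vec_eq_iff \<Gamma>_def sum_matrix_nth ring_map_sum[OF \<Psi>] \<Psi>_single coeff_Q N0 mult.commute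
        intro!: sum.cong)
  ultimately show ?thesis by simp
qed

section \<open>Points of the group over Laurent series\<close>

lemma ring_map_fls_const: "ring_map fls_const"
  by (rule ring_mapI) (simp_all add: fls_plus_const)

lemma ring_map_fps_to_fls: "ring_map (fps_to_fls :: 'a::comm_ring_1 fps \<Rightarrow> 'a fls)"
  by (rule ring_mapI) (simp_all add: fls_times_fps_to_fls)

lemma fls_times_nth_window:
  fixes f g :: "'a::comm_ring_1 fls"
  assumes "\<And>i. i < L \<Longrightarrow> fls_nth f i = 0" "\<And>i. i < L' \<Longrightarrow> fls_nth g i = 0"
  shows "fls_nth (f * g) n = (\<Sum>i=L..n - L'. fls_nth f i * fls_nth g (n - i))"
proof (cases "f = 0 \<or> g = 0")
  case False
  have "L \<le> fls_subdegree f" "L' \<le> fls_subdegree g"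
    using False assms[of "fls_subdegree f"] assms(2)[of "fls_subdegree g"] nth_fls_subdegree_nonzero
    by (metis linorder_not_less)+
  then have "(\<Sum>i=fls_subdegree f..n - fls_subdegree g. fls_nth f i * fls_nth g (n - i))
      = (\<Sum>i=L..n - L'. fls_nth f i * fls_nth g (n - i))"
    by (intro sum.mono_neutral_left) auto
  then show ?thesis by (simp add: fls_times_nth(2))
qed auto

lemma fls_common_bound:
  assumes "finite S"
  obtains L where "\<And>i m. i \<in> S \<Longrightarrow> m < L \<Longrightarrow> fls_nth (a i) m = 0"
proof -
  define L where "L = Min (insert 0 ((\<lambda>i. fls_subdegree (a i)) ` S))"
  have "L \<le> fls_subdegree (a i)" if "i \<in> S" for i
    unfolding L_def using assms that by (intro Min_le) auto
  then show ?thesis using that[of L] by (meson fls_eq0_below_subdegree order_less_le_trans)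
qed

text \<open>This reduces relations over \<open>k((z))\<close> to relations with coefficients in \<open>k\<close>, to which the ideal of
  the group can be applied. A coefficient of the sum involves only finitely many \<open>m\<close>, as the orders
  of the \<open>a i\<close> and \<open>b i\<close> are bounded below.\<close>

lemma fls_linear_relation:
  fixes a b :: "'i \<Rightarrow> 'a::comm_ring_1 fls"
  assumes "finite S" "\<And>m. (\<Sum>i\<in>S. fls_const (fls_nth (b i) m) * a i) = 0"
  shows "(\<Sum>i\<in>S. b i * a i) = 0"
proof (rule fls_eqI)
  fix n
  obtain L where L: "\<And>i m. i \<in> S \<Longrightarrow> m < L \<Longrightarrow> fls_nth (b i) m = 0"
    using fls_common_bound[OF assms(1)] by blast
  obtain L' where L': "\<And>i m. i \<in> S \<Longrightarrow> m < L' \<Longrightarrow> fls_nth (a i) m = 0"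
    using fls_common_bound[OF assms(1)] by blast
  have sum_nth: "fls_nth (sum f S) n = (\<Sum>i\<in>S. fls_nth (f i) n)" for f :: "'i \<Rightarrow> 'a fls" and n
    by (induction S rule: infinite_finite_induct) simp_all
  have "fls_nth (\<Sum>i\<in>S. b i * a i) n
      = (\<Sum>i\<in>S. \<Sum>m=L..n - L'. fls_nth (b i) m * fls_nth (a i) (n - m))"
    unfolding sum_nth by (intro sum.cong refl fls_times_nth_window) (auto simp: L L')
  also have "\<dots> = (\<Sum>m=L..n - L'. \<Sum>i\<in>S. fls_nth (b i) m * fls_nth (a i) (n - m))"
    by (rule sum.swap)
  also have "\<dots> = (\<Sum>m=L..n - L'. fls_nth (\<Sum>i\<in>S. fls_const (fls_nth (b i) m) * a i) (n - m))"
    by (simp add: sum_nth)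
  finally show "fls_nth (\<Sum>i\<in>S. b i * a i) n = fls_nth 0 n" by (simp add: assms(2))
qed

text \<open>Expand \<open>p(x y)\<close> into monomials of \<open>y\<close> with coefficients that are polynomials in \<open>x\<close>. For \<open>x\<close> in
  the group \<open>p(x h) = 0\<close>; taking coefficients of \<open>z\<^sup>N\<close> on both sides yields polynomials in \<open>x\<close> that
  vanish on the group, hence at \<open>x = g\<close>, and together they give \<open>p(g h) = 0\<close>.\<close>

lemma satisfies_ideal_mult:
  fixes g h :: "'k::field fls^'n^'n"
  assumes G: "subgroup G GL" and g: "satisfies_ideal fls_const G g" and h: "satisfies_ideal fls_const G h"
  shows "satisfies_ideal fls_const G (g ** h)"
  unfolding satisfies_ideal_def
proof
  fix p assume p: "p \<in> vanishing_ideal G"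
  \<comment> \<open>The comultiplication: \<open>p(xy)\<close> as a polynomial in \<open>y\<close> whose coefficients are polynomials in \<open>x\<close>.\<close>
  define \<iota> :: "('k, 'n) entry_poly \<Rightarrow> (('k, 'n) entry_poly, 'n) entry_poly" where "\<iota> = poly_const"
  have \<iota>: "ring_map \<iota>" unfolding \<iota>_def by (rule ring_map_poly_const)
  define q where "q = eval_entries (\<lambda>c. \<iota> (poly_const c)) (map_matrix \<iota> generic_matrix ** generic_matrix) p"
  define mono where "mono m = (\<Prod>(i, j)\<in>Poly_Mapping.keys m. (h $ i $ j) ^ Poly_Mapping.lookup m (i, j))"
    for m
  have eval_q: "eval_entries fls_const (x ** h) p
      = (\<Sum>m\<in>Poly_Mapping.keys q. mono m * eval_entries fls_const x (Poly_Mapping.lookup q m))" for x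
  proof -
    let ?\<psi> = "eval_entries fls_const x"
    have \<psi>: "ring_map ?\<psi>" by (rule ring_map_eval_entries[OF ring_map_fls_const])
    have "eval_entries ?\<psi> h q
      = eval_entries (\<lambda>c. eval_entries ?\<psi> h (\<iota> (poly_const c)))
         (map_matrix (eval_entries ?\<psi> h) (map_matrix \<iota> generic_matrix ** generic_matrix)) p"
      unfolding q_def by (rule eval_entries_ring_map[OF ring_map_eval_entries[OF \<psi>]])
    also have "\<dots> = eval_entries fls_const (x ** h) p"
      by (simp add: \<iota>_def eval_entries_const[OF \<psi>] eval_entries_const[OF ring_map_fls_const]
          map_matrix_mult[OF ring_map_eval_entries[OF \<psi>]] map_matrix_map_matrix
          eval_entries_generic_matrix[OF \<psi>] eval_entries_generic_matrix[OF ring_map_fls_const])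
    finally show ?thesis by (simp add: eval_entries_def mono_def mult.commute)
  qed
  have "(\<Sum>m\<in>Poly_Mapping.keys q. fls_const (fls_nth (mono m) N)
      * eval_entries fls_const g (Poly_Mapping.lookup q m)) = 0" for N
  proof -
    define r where "r = (\<Sum>m\<in>Poly_Mapping.keys q. poly_const (fls_nth (mono m) N) * Poly_Mapping.lookup q m)"
    have "eval_entries (\<lambda>a. a) x r = 0" if "x \<in> G" for x
    proof -
      have sum_nth: "fls_nth (sum f S) n = (\<Sum>i\<in>S. fls_nth (f i) n)"
        for f :: "(('n \<times> 'n) \<Rightarrow>\<^sub>0 nat) \<Rightarrow> 'k fls" and n S
        by (induction S rule: infinite_finite_induct) simp_all
      have "eval_entries fls_const (map_matrix fls_const x ** h) p = 0"
        using satisfies_ideal_translate(1)[OF G ring_map_fls_const that h] p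
        by (simp add: satisfies_ideal_def)
      then have "0 = fls_nth (\<Sum>m\<in>Poly_Mapping.keys q. mono m *
          fls_const (eval_entries (\<lambda>a. a) x (Poly_Mapping.lookup q m))) N"
        by (simp add: eval_q eval_entries_ring_map[OF ring_map_fls_const])
      also have "\<dots> = eval_entries (\<lambda>a. a) x r"
        by (simp add: sum_nth r_def ring_map_sum[OF ring_map_eval_entries[OF ring_map_id]]
            ring_map_mult[OF ring_map_eval_entries[OF ring_map_id]] eval_entries_const[OF ring_map_id])
      finally show ?thesis by simp
    qed
    then have "r \<in> vanishing_ideal G" by (simp add: vanishing_ideal_def)
    then have "eval_entries fls_const g r = 0" using g by (simp add: satisfies_ideal_def)
    then show ?thesis
      by (simp add: r_def ring_map_sum[OF ring_map_eval_entries[OF ring_map_fls_const]]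
            ring_map_mult[OF ring_map_eval_entries[OF ring_map_fls_const]]
            eval_entries_const[OF ring_map_fls_const])
  qed
  then show "eval_entries fls_const (g ** h) p = 0"
    unfolding eval_q
    by (rule fls_linear_relation[OF finite_keys, where b = mono
          and a = "\<lambda>m. eval_entries fls_const g (Poly_Mapping.lookup q m)"])
qed

lemma points_mult:
  fixes g h :: "'k::field fls^'n^'n"
  assumes "subgroup G GL" "g \<in> points fls_const G" "h \<in> points fls_const G"
  shows "g ** h \<in> points fls_const G"
  using assms by (simp add: points_iff satisfies_ideal_mult invertible_mult)

lemma ring_map_fls_compose_power:
  "d > 0 \<Longrightarrow> ring_map (\<lambda>f :: 'k::idom fls. fls_compose_power f d)"
  by (rule ring_mapI) simp_all

lemma points_compose_power:
  fixes g :: "'k::field fls^'n^'n"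
  assumes "g \<in> points fls_const G" "d > 0"
  shows "map_matrix (\<lambda>f. fls_compose_power f d) g \<in> points fls_const G"
proof -
  have "satisfies_ideal (\<lambda>x :: 'k. fls_compose_power (fls_const x) d) G (map_matrix (\<lambda>f. fls_compose_power f d) g)"
    using assms satisfies_ideal_ring_map[OF ring_map_fls_compose_power[OF assms(2)], of fls_const G g]
    by (simp only: points_iff)
  then show ?thesis
    using assms invertible_map_matrix[OF ring_map_fls_compose_power[OF assms(2)], of g]
    by (simp add: points_iff)
qed

lemma det_map_matrix:
  assumes "ring_map \<theta>"
  shows "det (map_matrix \<theta> A) = \<theta> (det A)"
proof -
  have of_nat: "\<theta> (of_nat n) = of_nat n" for n
    by (induction n) (simp_all add: ring_map_0[OF assms] ring_map_1[OF assms] ring_map_add[OF assms])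
  have "\<theta> (of_int z) = of_int z" for z
    by (cases z) (simp_all add: of_nat ring_map_minus[OF assms] ring_map_1[OF assms] ring_map_add[OF assms]
        ring_map_diff[OF assms])
  then show ?thesis
    by (simp add: det_def ring_map_sum[OF assms] ring_map_mult[OF assms] ring_map_prod[OF assms])
qed

text \<open>The determinant of \<open>g\<close> has constant term 1.\<close>

lemma fps_points:
  fixes g :: "'k::field fps^'n^'n"
  assumes "satisfies_ideal fps_const G g" "fps_coeff 0 g = mat 1"
  shows "map_matrix fps_to_fls g \<in> points fls_const G"
proof -
  have "fps_nth (det g) 0 = 1"
    using det_map_matrix[OF ring_map_fps_nth_0, of g] assms(2) by simp
  then have "det (map_matrix fps_to_fls g) \<noteq> 0"
    by (auto simp: det_map_matrix[OF ring_map_fps_to_fls])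
  moreover have "satisfies_ideal (\<lambda>c. fps_to_fls (fps_const c)) G (map_matrix fps_to_fls g)"
    by (rule satisfies_ideal_ring_map[OF ring_map_fps_to_fls assms(1)])
  ultimately show ?thesis by (simp add: points_iff invertible_det_nz)
qed

section \<open>The normal form of a regular connection\<close>

text \<open>In a linear relation between \<open>s, T s, T\<^sup>2 s, \<dots>\<close> let \<open>T\<^sup>e s\<close> be the first term with a nonzero
  coefficient. The relation then expresses it as \<open>T\<^sup>e (T u)\<close> for some combination \<open>u\<close> of the iterates.\<close>

lemma fitting_correction:
  fixes T :: "'k::field^'n^'n \<Rightarrow> 'k^'n^'n"
  assumes add: "\<And>x y. T (x + y) = T x + T y" and scale: "\<And>c x. T (c *m x) = c *m T x"
    and V: "\<And>x y. x \<in> V \<Longrightarrow> y \<in> V \<Longrightarrow> x + y \<in> V" "\<And>c x. x \<in> V \<Longrightarrow> c *m x \<in> V" "0 \<in> V"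
      "\<And>x. x \<in> V \<Longrightarrow> T x \<in> V"
    and s: "s \<in> V"
  obtains u e where "u \<in> V" "(T ^^ e) (s - T u) = 0"
proof -
  have T0: "T 0 = 0" using scale[of 0 0] by simp
  have pow_add: "(T ^^ e) (x + y) = (T ^^ e) x + (T ^^ e) y" for e x y
    by (induction e) (simp_all add: add)
  have pow_scale: "(T ^^ e) (c *m x) = c *m (T ^^ e) x" for e c x
    by (induction e) (simp_all add: scale)
  have pow_diff: "(T ^^ e) (x - y) = (T ^^ e) x - (T ^^ e) y" for e x y
    using pow_add[of e x "(-1) *m y"] pow_scale[of e "-1" y] by (simp add: scale_mat_left_distribs)
  have pow_0: "(T ^^ e) 0 = 0" for e by (induction e) (simp_all add: T0)
  have pow_sum: "(T ^^ e) (sum f S) = (\<Sum>i\<in>S. (T ^^ e) (f i))" for e f and S :: "nat set"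
    by (induction S rule: infinite_finite_induct) (simp_all add: pow_add pow_0)
  have pow_V: "(T ^^ e) x \<in> V" if "x \<in> V" for e x
    using that by (induction e) (simp_all add: V(4))
  have sum_V: "sum f S \<in> V" if "\<And>i. i \<in> S \<Longrightarrow> f i \<in> V" for f and S :: "nat set"
    using that by (induction S rule: infinite_finite_induct) (simp_all add: V)
  obtain a K where a: "\<exists>i\<le>K. a i \<noteq> 0" "(\<Sum>i\<le>K. a i *m (T ^^ i) s) = 0"
    by (rule matrix_sequence_dependent[of "\<lambda>i. (T ^^ i) s"])
  define e where "e = (LEAST i. a i \<noteq> 0)"
  have ae: "a e \<noteq> 0" unfolding e_def using a(1) LeastI_ex[of "\<lambda>i. a i \<noteq> 0"] by auto
  have below: "a i = 0" if "i < e" for i using not_less_Least[of i "\<lambda>i. a i \<noteq> 0"] that e_def by blast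
  have eK: "e \<le> K" using a(1) below by (meson linorder_not_less order_trans)
  define u where "u = (\<Sum>i=Suc e..K. (- a i / a e) *m (T ^^ (i - Suc e)) s)"
  have u: "u \<in> V" unfolding u_def by (intro sum_V V(2) pow_V s)
  have Tu: "T u = (\<Sum>i=Suc e..K. (- a i / a e) *m (T ^^ (i - e)) s)"
    using pow_sum[of 1 "\<lambda>i. (- a i / a e) *m (T ^^ (i - Suc e)) s" "{Suc e..K}"]
    by (auto simp: u_def scale funpow_swap1 Suc_diff_Suc[symmetric] intro!: sum.cong)
  have "a e *m (T ^^ e) (s - T u) = (\<Sum>i=e..K. a i *m (T ^^ i) s)"
  proof -
    have "a e *m (T ^^ e) (s - T u)
        = a e *m (T ^^ e) s - (\<Sum>i=Suc e..K. a e *m (- a i / a e) *m (T ^^ e) ((T ^^ (i - e)) s))"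
      by (simp only: pow_diff pow_scale Tu pow_sum scale_mat_right_distribs scale_mat_sum)
    also have "(\<Sum>i=Suc e..K. a e *m (- a i / a e) *m (T ^^ e) ((T ^^ (i - e)) s))
        = (\<Sum>i=Suc e..K. - (a i *m (T ^^ i) s))"
    proof (rule sum.cong)
      fix i assume "i \<in> {Suc e..K}"
      then have "(T ^^ e) ((T ^^ (i - e)) s) = (T ^^ i) s"
        by (metis Suc_leD atLeastAtMost_iff comp_apply funpow_add le_add_diff_inverse)
      then show "a e *m (- a i / a e) *m (T ^^ e) ((T ^^ (i - e)) s) = - (a i *m (T ^^ i) s)"
        using ae by (simp add: scale_mat_scale_mat scale_mat_left_distribs scale_mat_right_distribs)
    qed simp
    finally show ?thesis
      using eK by (simp add: sum_negf sum.atLeast_Suc_atMost)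
  qed
  also have "\<dots> = (\<Sum>i\<le>K. a i *m (T ^^ i) s)"
    by (rule sum.mono_neutral_left) (auto simp: below)
  finally have "(T ^^ e) (s - T u) = 0" using a(2) ae by (simp add: scale_mat_eq_0_iff)
  then show ?thesis using u that by blast
qed

text \<open>The terms are chosen one after the other; a later choice does not affect an earlier condition.\<close>

lemma stepwise_sequence:
  fixes Q :: "(nat \<Rightarrow> 'a) \<Rightarrow> nat \<Rightarrow> bool"
  assumes step: "\<And>C N. \<exists>c. Q (C(N := c)) N"
    and local: "\<And>C C' N. (\<And>i. i \<le> N \<Longrightarrow> C i = C' i) \<Longrightarrow> Q C N \<Longrightarrow> Q C' N"
  obtains C where "\<And>N. Q C N"
proof -
  define F where "F = rec_nat undefined (\<lambda>N f. f(N := SOME c. Q (f(N := c)) N))"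
  have F_Suc: "F (Suc N) = (F N)(N := SOME c. Q ((F N)(N := c)) N)" for N
    by (simp add: F_def)
  have Q: "Q (F (Suc N)) N" for N
    unfolding F_Suc by (rule someI_ex) (rule step)
  have stable: "F (Suc i + k) i = F (Suc i) i" for i k
    by (induction k) (simp_all add: F_Suc)
  have "Q (\<lambda>i. F (Suc i) i) N" for N
  proof (rule local[OF _ Q[of N]])
    fix i assume "i \<le> N"
    then show "F (Suc N) i = F (Suc i) i" using stable[of i "N - i"] by simp
  qed
  then show ?thesis by (rule that)
qed

subsection \<open>Matrices of power series\<close>

definition fps_matrix :: "(nat \<Rightarrow> 'a^'n^'n) \<Rightarrow> 'a fps^'n^'n" where
  "fps_matrix s = (\<chi> i j. Abs_fps (\<lambda>m. s m $ i $ j))"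

lemma fps_coeff_fps_matrix [simp]: "fps_coeff m (fps_matrix s) = s m"
  by (simp add: vec_eq_iff fps_matrix_def)

lemma fps_matrix_eqI: "(\<And>m. fps_coeff m A = fps_coeff m B) \<Longrightarrow> A = B"
  by (simp add: vec_eq_iff fps_eq_iff)

lemma sum_atMost_rev: "(\<Sum>i\<le>n::nat. f i) = (\<Sum>i\<le>n. f (n - i))"
  by (rule sum.reindex_bij_witness[of _ "\<lambda>i. n - i" "\<lambda>i. n - i"]) auto

lemma fps_coeff_mult:
  "fps_coeff n (A ** B) = (\<Sum>i\<le>n. fps_coeff i A ** fps_coeff (n - i) (B :: 'a::comm_ring_1 fps^'n^'n))"
proof -
  have "fps_coeff n (A ** B) $ a $ b
      = (\<Sum>i\<le>n. fps_coeff i A ** fps_coeff (n - i) B) $ a $ b" for a b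
  proof -
    have "fps_coeff n (A ** B) $ a $ b
        = (\<Sum>l\<in>UNIV. \<Sum>i\<le>n. fps_nth (A $ a $ l) i * fps_nth (B $ l $ b) (n - i))"
      by (simp add: matrix_mult_nth fps_sum_nth fps_mult_nth atLeast0AtMost)
    also have "\<dots> = (\<Sum>i\<le>n. fps_coeff i A ** fps_coeff (n - i) B) $ a $ b"
      by (subst sum.swap) (simp add: sum_matrix_nth matrix_mult_nth)
    finally show ?thesis .
  qed
  then show ?thesis unfolding vec_eq_iff by blast
qed

definition euler :: "'a::comm_ring_1 fps^'n^'n \<Rightarrow> 'a fps^'n^'n" where
  "euler A = map_matrix (\<lambda>f. fps_X * fps_deriv f) A"

lemma fps_coeff_euler: "fps_coeff n (euler A) = of_nat n *m fps_coeff n A"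
  by (cases n) (simp_all add: vec_eq_iff euler_def)

lemma euler_mult: "euler (A ** B) = euler A ** B + A ** euler B"
  by (simp add: vec_eq_iff euler_def matrix_mult_nth fps_deriv_sum sum_distrib_left sum.distrib
      algebra_simps)

lemma euler_diff: "euler (A - B) = euler A - euler B"
  by (simp add: vec_eq_iff euler_def algebra_simps)

lemma fps_ode_unique:
  fixes U C :: "'k::field_char_0 fps^'n^'n"
  assumes "euler U = C ** U" "fps_coeff 0 C = 0" "fps_coeff 0 U = 0"
  shows "U = 0"
proof -
  have "fps_coeff n U = 0" for n
  proof (induction n rule: less_induct)
    case (less n)
    show ?case
    proof (cases "n = 0")
      case False
      have "fps_coeff i C ** fps_coeff (n - i) U = 0" if "i \<le> n" for i
        using assms(2) less[of "n - i"] that False by (cases "i = 0") simp_all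
      then have "of_nat n *m fps_coeff n U = 0"
        by (simp add: fps_coeff_euler[symmetric] assms(1) fps_coeff_mult)
      then show ?thesis using False by (simp add: scale_mat_eq_0_iff)
    qed (simp add: assms(3))
  qed
  then show ?thesis by (intro fps_matrix_eqI) (simp add: vec_eq_iff)
qed

text \<open>The solution \<open>g\<close> of \<open>z g' = C g\<close> with \<open>g(0) = 1\<close>.\<close>

fun transport_coeff :: "(nat \<Rightarrow> 'k::field^'n^'n) \<Rightarrow> nat \<Rightarrow> 'k^'n^'n" where
  "transport_coeff C 0 = mat 1"
| "transport_coeff C (Suc i) = inverse (of_nat (Suc i)) *m
     (\<Sum>j\<le>i. C (Suc j) ** transport_coeff C (i - j))"

text \<open>The coefficients of \<open>W = g Y g\<^sup>-\<^sup>1\<close> for the same \<open>g\<close>. The equation \<open>z W' = [C, W]\<close> computes them with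
  Lie brackets only, which keeps them in the Lie algebra.\<close>

fun conjugate_coeff :: "(nat \<Rightarrow> 'k::field^'n^'n) \<Rightarrow> 'k^'n^'n \<Rightarrow> nat \<Rightarrow> 'k^'n^'n" where
  "conjugate_coeff C Y 0 = Y"
| "conjugate_coeff C Y (Suc i) = inverse (of_nat (Suc i)) *m
     (\<Sum>j\<le>i. C (Suc j) ** conjugate_coeff C Y (i - j) - conjugate_coeff C Y (i - j) ** C (Suc j))"

lemma euler_transport:
  fixes C :: "nat \<Rightarrow> 'k::field_char_0^'n^'n"
  assumes "C 0 = 0"
  shows "euler (fps_matrix (transport_coeff C)) = fps_matrix C ** fps_matrix (transport_coeff C)"
proof (rule fps_matrix_eqI)
  fix n
  show "fps_coeff n (euler (fps_matrix (transport_coeff C)))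
      = fps_coeff n (fps_matrix C ** fps_matrix (transport_coeff C))"
  proof (cases n)
    case (Suc i)
    then show ?thesis
      by (simp add: fps_coeff_euler fps_coeff_mult scale_mat_scale_mat assms sum.atMost_Suc_shift
          del: of_nat_Suc sum.atMost_Suc)
  qed (simp add: fps_coeff_euler fps_coeff_mult assms)
qed

lemma euler_conjugate:
  fixes C :: "nat \<Rightarrow> 'k::field_char_0^'n^'n"
  assumes "C 0 = 0"
  shows "euler (fps_matrix (conjugate_coeff C Y)) = fps_matrix C ** fps_matrix (conjugate_coeff C Y)
    - fps_matrix (conjugate_coeff C Y) ** fps_matrix C"
proof (rule fps_matrix_eqI)
  fix n
  have diff: "fps_coeff k (A - B) = fps_coeff k A - fps_coeff k B" for k and A B :: "'k fps^'n^'n"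
    by (simp add: vec_eq_iff)
  show "fps_coeff n (euler (fps_matrix (conjugate_coeff C Y)))
      = fps_coeff n (fps_matrix C ** fps_matrix (conjugate_coeff C Y)
        - fps_matrix (conjugate_coeff C Y) ** fps_matrix C)"
  proof (cases n)
    case (Suc i)
    have "fps_coeff n (fps_matrix (conjugate_coeff C Y) ** fps_matrix C)
        = (\<Sum>j\<le>n. conjugate_coeff C Y (n - j) ** C j)"
      unfolding fps_coeff_mult by (subst sum_atMost_rev) simp
    then show ?thesis unfolding diff using Suc
      by (simp add: fps_coeff_euler fps_coeff_mult scale_mat_scale_mat assms sum.atMost_Suc_shift
          sum_subtractf del: of_nat_Suc sum.atMost_Suc)
  qed (simp add: diff fps_coeff_euler fps_coeff_mult assms)
qed

text \<open>The difference \<open>U\<close> of the two sides satisfies \<open>z U' = C U\<close> and \<open>U(0) = 0\<close>.\<close>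

lemma transport_conjugate:
  fixes C :: "nat \<Rightarrow> 'k::field_char_0^'n^'n"
  assumes "C 0 = 0"
  shows "fps_matrix (transport_coeff C) ** map_matrix fps_const Y
    = fps_matrix (conjugate_coeff C Y) ** fps_matrix (transport_coeff C)"
proof -
  let ?g = "fps_matrix (transport_coeff C)" and ?W = "fps_matrix (conjugate_coeff C Y)"
    and ?Y = "map_matrix fps_const Y" and ?C = "fps_matrix C"
  have Y: "euler ?Y = 0" by (simp add: euler_def vec_eq_iff)
  have "?g ** ?Y - ?W ** ?g = 0"
  proof (rule fps_ode_unique)
    show "euler (?g ** ?Y - ?W ** ?g) = ?C ** (?g ** ?Y - ?W ** ?g)"
      by (simp add: euler_diff euler_mult euler_transport[where C = C, OF assms] euler_conjugate[where C = C, OF assms] Y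
          matrix_distribs matrix_mul_assoc)
    show "fps_coeff 0 ?C = 0" by (simp add: assms)
    have "fps_coeff 0 (A - B) = fps_coeff 0 A - fps_coeff 0 B" for A B :: "'k fps^'n^'n"
      by (simp add: vec_eq_iff)
    moreover have "fps_coeff 0 ?Y = Y" by (simp add: vec_eq_iff)
    ultimately show "fps_coeff 0 (?g ** ?Y - ?W ** ?g) = 0"
      by (simp add: fps_coeff_mult)
  qed
  then show ?thesis by simp
qed

lemma transport_conjugate_series:
  fixes C :: "nat \<Rightarrow> 'k::field_char_0^'n^'n"
  assumes "C 0 = 0"
  shows "fps_matrix (transport_coeff C) ** fps_matrix A
    = fps_matrix (\<lambda>N. \<Sum>m\<le>N. conjugate_coeff C (A m) (N - m)) ** fps_matrix (transport_coeff C)"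
proof (rule fps_matrix_eqI)
  fix N
  let ?g = "transport_coeff C" and ?W = "\<lambda>m. conjugate_coeff C (A m)"
  have conj: "?g n ** Y = (\<Sum>i\<le>n. conjugate_coeff C Y i ** ?g (n - i))" for n Y
  proof -
    have "fps_coeff n (fps_matrix ?g ** map_matrix fps_const Y)
        = (\<Sum>i\<le>n. if i = n then ?g n ** Y else 0)"
      unfolding fps_coeff_mult
    proof (rule sum.cong)
      fix i assume "i \<in> {..n}"
      moreover have "fps_coeff k (map_matrix fps_const Y) = (if k = 0 then Y else 0)" for k
        by (simp add: vec_eq_iff)
      ultimately show "fps_coeff i (fps_matrix ?g) ** fps_coeff (n - i) (map_matrix fps_const Y)
          = (if i = n then ?g n ** Y else 0)"
        by simp
    qed simp
    then show ?thesis by (simp add: transport_conjugate[where C = C, OF assms] fps_coeff_mult)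
  qed
  have "fps_coeff N (fps_matrix ?g ** fps_matrix A) = (\<Sum>m\<le>N. ?g (N - m) ** A m)"
    unfolding fps_coeff_mult by (subst sum_atMost_rev) simp
  also have "\<dots> = (\<Sum>m\<le>N. \<Sum>i\<le>N - m. ?W m i ** ?g (N - m - i))"
    by (simp add: conj)
  also have "\<dots> = (\<Sum>(m, i)\<in>{(m, i). m + i \<le> N}. ?W m i ** ?g (N - m - i))"
    by (subst sum.Sigma) (auto intro!: sum.cong)
  also have "\<dots> = (\<Sum>l\<le>N. \<Sum>m\<le>l. ?W m (l - m) ** ?g (N - m - (l - m)))"
    by (rule sum.triangle_reindex_eq)
  also have "\<dots> = (\<Sum>l\<le>N. (\<Sum>m\<le>l. ?W m (l - m)) ** ?g (N - l))"
    by (simp add: matrix_sum_rdistrib)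
  finally show "fps_coeff N (fps_matrix ?g ** fps_matrix A)
      = fps_coeff N (fps_matrix (\<lambda>N. \<Sum>m\<le>N. ?W m (N - m)) ** fps_matrix ?g)"
    by (simp add: fps_coeff_mult)
qed

lemma conjugate_coeff_cong:
  assumes "\<And>i. i \<le> n \<Longrightarrow> C i = C' i"
  shows "conjugate_coeff C Y n = conjugate_coeff C' Y n"
  using assms
proof (induction n rule: less_induct)
  case (less n)
  show ?case
  proof (cases n)
    case (Suc i)
    have "conjugate_coeff C Y (i - j) = conjugate_coeff C' Y (i - j)" for j
      using less.prems by (intro less.IH) (auto simp: Suc)
    then show ?thesis using less.prems by (auto simp: Suc intro!: sum.cong arg_cong[of _ _ "scale_mat _"])
  qed simp
qed

text \<open>The coefficient \<open>C N\<close> enters only through the bracket with the constant term \<open>Y\<close>.\<close>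

lemma conjugate_coeff_last:
  assumes "N > 0"
  shows "conjugate_coeff (C(N := c)) Y N
    = conjugate_coeff (C(N := 0)) Y N + inverse (of_nat N) *m (c ** Y - Y ** c)"
proof -
  obtain i where N: "N = Suc i" using assms by (cases N) auto
  have low: "conjugate_coeff (C(N := c)) Y (i - j) = conjugate_coeff (C(N := 0)) Y (i - j)" for j
    by (rule conjugate_coeff_cong) (auto simp: N)
  let ?f = "\<lambda>c j. (C(N := c)) (Suc j) ** conjugate_coeff (C(N := 0)) Y (i - j)
      - conjugate_coeff (C(N := 0)) Y (i - j) ** (C(N := c)) (Suc j)"
  have split: "(\<Sum>j\<le>i. ?f c j) = (\<Sum>j<i. ?f 0 j) + (c ** Y - Y ** c)" for c
  proof -
    have "(\<Sum>j\<le>i. ?f c j) = (\<Sum>j<i. ?f c j) + ?f c i"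
      by (simp only: lessThan_Suc_atMost[symmetric] sum.lessThan_Suc)
    moreover have "(\<Sum>j<i. ?f c j) = (\<Sum>j<i. ?f 0 j)"
      by (rule sum.cong) (auto simp: N)
    moreover have "?f c i = c ** Y - Y ** c" by (simp add: N)
    ultimately show ?thesis by (simp only:)
  qed
  have "conjugate_coeff (C(N := c)) Y N = inverse (of_nat N) *m (\<Sum>j\<le>i. ?f c j)"
    unfolding N conjugate_coeff.simps(2) unfolding N[symmetric] low ..
  also have "\<dots> = inverse (of_nat N) *m (\<Sum>j\<le>i. ?f 0 j) + inverse (of_nat N) *m (c ** Y - Y ** c)"
    unfolding split[of c] split[of 0] by (simp only: scale_mat_right_distribs) simp
  also have "inverse (of_nat N) *m (\<Sum>j\<le>i. ?f 0 j) = conjugate_coeff (C(N := 0)) Y N"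
    unfolding N conjugate_coeff.simps(2) ..
  finally show ?thesis .
qed

lemma conjugate_coeff_lie:
  assumes "subgroup G GL" "\<And>i. i \<le> n \<Longrightarrow> C i \<in> lie_algebra G" "Y \<in> lie_algebra G"
  shows "conjugate_coeff C Y n \<in> lie_algebra G"
  using assms(2)
proof (induction n rule: less_induct)
  case (less n)
  show ?case
  proof (cases n)
    case (Suc i)
    have "conjugate_coeff C Y (i - j) \<in> lie_algebra G" for j
      using less.prems by (intro less.IH) (auto simp: Suc)
    then show ?thesis using less.prems unfolding Suc conjugate_coeff.simps(2)
      by (intro lie_algebra_scale[OF assms(1)] lie_algebra_sum[OF assms(1)] lie_algebra_bracket[OF assms(1)])
        auto
  qed (simp add: assms(3))
qed

abbreviation shifted_ad :: "'k::comm_ring_1^'n^'n \<Rightarrow> 'k \<Rightarrow> 'k^'n^'n \<Rightarrow> 'k^'n^'n" where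
  "shifted_ad A c Y \<equiv> A ** Y - Y ** A - c *m Y"

text \<open>Let \<open>g\<close> solve \<open>z g' = C g\<close>. It transforms \<open>A\<close> into \<open>B = g A g\<^sup>-\<^sup>1 + C\<close>. With the lower coefficients of
  \<open>C\<close> fixed, the coefficient \<open>B\<^sub>N\<close> changes by \<open>- (ad A\<^sub>0 - N) c / N\<close> when \<open>C\<^sub>N\<close> changes by \<open>c\<close>. By
  Fitting's decomposition \<open>c\<close> can be chosen so that \<open>B\<^sub>N\<close> lies in the generalised eigenspace of
  \<open>ad A\<^sub>0\<close> for the eigenvalue \<open>N\<close>.\<close>

lemma resonant_normal_form:
  fixes A :: "nat \<Rightarrow> 'k::field_char_0^'n^'n"
  assumes G: "subgroup G GL" and A: "\<And>m. A m \<in> lie_algebra G"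
  obtains g B where "satisfies_ideal fps_const G g" "fps_coeff 0 g = mat 1"
    "g ** fps_matrix A + euler g = fps_matrix B ** g"
    "\<And>m. B m \<in> lie_algebra G" "B 0 = A 0"
    "\<And>m. m > 0 \<Longrightarrow> \<exists>e. (shifted_ad (A 0) (of_nat m) ^^ e) (B m) = 0"
proof -
  define B where "B C N = C N + (\<Sum>m\<le>N. conjugate_coeff C (A m) (N - m))" for C N
  \<comment> \<open>The value \<open>C 0 = 0\<close> gives \<open>C\<close> no constant term, so that the differential equation has a solution
    with \<open>g(0) = 1\<close>.\<close>
  define Q where "Q C N \<longleftrightarrow> (if N = 0 then C 0 = 0 else (\<forall>i<N. C i \<in> lie_algebra G) \<longrightarrow>
    C N \<in> lie_algebra G \<and> (\<exists>e. (shifted_ad (A 0) (of_nat N) ^^ e) (B C N) = 0))" for C N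
  have B_cong: "B C N = B C' N" if "\<And>i. i \<le> N \<Longrightarrow> C i = C' i" for C C' N
  proof -
    have "conjugate_coeff C (A m) (N - m) = conjugate_coeff C' (A m) (N - m)" for m
      by (rule conjugate_coeff_cong) (use that in auto)
    then show ?thesis using that[of N] by (simp add: B_def)
  qed
  have B_lie: "B C N \<in> lie_algebra G" if "\<And>i. i \<le> N \<Longrightarrow> C i \<in> lie_algebra G" for C N
    unfolding B_def using that
    by (intro lie_algebra_add[OF G] lie_algebra_sum[OF G] conjugate_coeff_lie[OF G] A) auto
  have step: "\<exists>c. Q (C(N := c)) N" for C N
  proof (cases "N > 0 \<and> (\<forall>i<N. C i \<in> lie_algebra G)")
    case True
    define s where "s = B (C(N := 0)) N"
    have s: "s \<in> lie_algebra G"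
      unfolding s_def by (rule B_lie) (use True lie_algebra_0[OF G] in auto)
    have last: "B (C(N := c)) N = s + c + inverse (of_nat N) *m (c ** A 0 - A 0 ** c)" for c
    proof -
      have "conjugate_coeff (C(N := c)) (A m) (N - m) = conjugate_coeff (C(N := 0)) (A m) (N - m)
          + (if m = 0 then inverse (of_nat N) *m (c ** A 0 - A 0 ** c) else 0)" if "m \<le> N" for m
      proof (cases "m = 0")
        case True
        then show ?thesis using conjugate_coeff_last[of N C c "A 0"] \<open>N > 0 \<and> _\<close> by simp
      next
        case False
        then show ?thesis using that by (simp, intro conjugate_coeff_cong) auto
      qed
      then have "(\<Sum>m\<le>N. conjugate_coeff (C(N := c)) (A m) (N - m))
          = (\<Sum>m\<le>N. conjugate_coeff (C(N := 0)) (A m) (N - m))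
            + inverse (of_nat N) *m (c ** A 0 - A 0 ** c)"
        by (simp add: sum.distrib)
      then show ?thesis by (simp add: B_def s_def algebra_simps)
    qed
    let ?T = "shifted_ad (A 0) (of_nat N)"
    obtain u e where u: "u \<in> lie_algebra G" "(?T ^^ e) (s - ?T u) = 0"
    proof (rule fitting_correction[of ?T "lie_algebra G" s])
      show "?T (x + y) = ?T x + ?T y" for x y by (simp add: mat_alg)
      show "?T (c *m x) = c *m ?T x" for c x by (simp add: mat_alg mult.commute)
      show "x + y \<in> lie_algebra G" if "x \<in> lie_algebra G" "y \<in> lie_algebra G" for x y
        using that by (rule lie_algebra_add[OF G])
      show "c *m x \<in> lie_algebra G" if "x \<in> lie_algebra G" for c x
        using that by (rule lie_algebra_scale[OF G])
      show "0 \<in> lie_algebra G" by (rule lie_algebra_0[OF G])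
      show "?T x \<in> lie_algebra G" if "x \<in> lie_algebra G" for x
        using that by (intro lie_algebra_diff[OF G] lie_algebra_bracket[OF G] lie_algebra_scale[OF G] A)
      show "s \<in> lie_algebra G" by (rule s)
    qed (use that in blast)
    have "s - ?T u = B (C(N := of_nat N *m u)) N"
      unfolding last using True by (simp add: mat_alg)
    then show ?thesis
      using u True lie_algebra_scale[OF G u(1)] by (intro exI[of _ "of_nat N *m u"]) (auto simp: Q_def)
  next
    case False
    then show ?thesis by (auto simp: Q_def)
  qed
  obtain C where C: "\<And>N. Q C N"
  proof (rule stepwise_sequence[of Q, OF step])
    fix C C' :: "nat \<Rightarrow> 'k^'n^'n" and N
    assume "\<And>i. i \<le> N \<Longrightarrow> C i = C' i" "Q C N"
    then show "Q C' N" using B_cong[of N C C'] by (auto simp: Q_def)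
  qed (use that in blast)
  have C0: "C 0 = 0" using C[of 0] by (simp add: Q_def)
  have C_lie: "C N \<in> lie_algebra G" for N
  proof (induction N rule: less_induct)
    case (less N)
    then show ?case using C[of N] C0 lie_algebra_0[OF G] by (auto simp: Q_def split: if_splits)
  qed
  let ?g = "fps_matrix (transport_coeff C)"
  have "fps_matrix (B C) = fps_matrix C + fps_matrix (\<lambda>N. \<Sum>m\<le>N. conjugate_coeff C (A m) (N - m))"
    by (rule fps_matrix_eqI) (simp add: vec_eq_iff B_def fps_matrix_def)
  then have "?g ** fps_matrix A + euler ?g = fps_matrix (B C) ** ?g"
    by (simp add: transport_conjugate_series[where C = C, OF C0] euler_transport[where C = C, OF C0] matrix_distribs add.commute)
  moreover have "satisfies_ideal fps_const G ?g"
    by (rule fps_ode_satisfies_ideal[OF G, of "fps_matrix C"])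
      (simp_all add: C_lie C0 euler_transport[where C = C, OF C0, unfolded euler_def])
  moreover have "B C 0 = A 0" by (simp add: B_def C0)
  moreover have "\<exists>e. (shifted_ad (A 0) (of_nat m) ^^ e) (B C m) = 0" if "m > 0" for m
    using C[of m] C_lie that by (auto simp: Q_def)
  ultimately show ?thesis using that[of ?g "B C"] B_lie C_lie by simp
qed

section \<open>Gauge transformations\<close>

definition fls_euler :: "'a::comm_ring_1 fls^'n^'n \<Rightarrow> 'a fls^'n^'n" where
  "fls_euler A = map_matrix (\<lambda>f. fls_X * fls_deriv f) A"

lemma fls_nth_euler: "fls_nth (fls_X * fls_deriv f) n = of_int n * fls_nth (f :: 'a::comm_ring_1 fls) n"
  by (simp add: fls_X_times_conv_shift)

lemma fls_euler_mult: "fls_euler (A ** B) = fls_euler A ** B + A ** fls_euler B"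
  by (simp add: vec_eq_iff fls_euler_def matrix_mult_nth fls_deriv_sum sum_distrib_left sum.distrib
      algebra_simps)

lemma fls_euler_fps_to_fls: "fls_euler (map_matrix fps_to_fls g) = map_matrix fps_to_fls (euler g)"
  by (simp add: vec_eq_iff fls_euler_def euler_def fls_deriv_fps_to_fls fls_times_fps_to_fls)

lemma
  assumes "invertible A"
  shows matrix_inv_right: "A ** matrix_inv A = mat 1"
    and matrix_inv_left: "matrix_inv A ** A = mat 1"
  using someI_ex[OF assms[unfolded invertible_def]] by (simp_all add: matrix_inv_def)

text \<open>The form without inverses, in which gauge transformations are composed and pulled back.\<close>

lemma gauge_eq_iff:
  assumes "invertible g"
  shows "gauge g A = B \<longleftrightarrow> g ** A + fls_euler g = B ** g"
proof -
  have g: "gauge g A = (g ** A + fls_euler g) ** matrix_inv g"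
    by (simp add: gauge_def fls_euler_def matrix_distribs)
  have "gauge g A ** g = g ** A + fls_euler g"
    by (simp add: g matrix_mul_assoc[symmetric] matrix_inv_left[OF assms])
  moreover have "gauge g A = B" if "g ** A + fls_euler g = B ** g"
    by (simp add: g that matrix_mul_assoc[symmetric] matrix_inv_right[OF assms])
  ultimately show ?thesis by auto
qed

lemma gauge_mult:
  assumes "invertible g" "invertible h"
  shows "gauge (h ** g) A = gauge h (gauge g A)"
proof -
  define B where "B = gauge g A"
  define C where "C = gauge h B"
  have g: "g ** A + fls_euler g = B ** g" using B_def gauge_eq_iff[OF assms(1)] by metis
  have h: "h ** B + fls_euler h = C ** h" using C_def gauge_eq_iff[OF assms(2)] by metis
  have "(h ** g) ** A + fls_euler (h ** g) = h ** (g ** A + fls_euler g) + fls_euler h ** g"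
    by (simp add: fls_euler_mult matrix_distribs matrix_mul_assoc)
  also have "\<dots> = (h ** B + fls_euler h) ** g"
    by (simp add: g matrix_distribs matrix_mul_assoc)
  also have "\<dots> = C ** (h ** g)" by (simp add: h matrix_mul_assoc)
  finally show ?thesis
    using gauge_eq_iff[OF invertible_mult[OF assms(2,1)]] by (simp add: B_def C_def)
qed

lemma fls_nth_of_nat_mult: "fls_nth (of_nat n * f) m = of_nat n * fls_nth (f :: 'a::comm_ring_1 fls) m"
  by (simp add: fls_of_nat)

lemma pullback_gauge:
  fixes g A :: "'k::field fls^'n^'n"
  assumes "invertible g" "n > 0"
  shows "pullback n (gauge g A) = gauge (map_matrix (\<lambda>f. fls_compose_power f n) g) (pullback n A)"
proof -
  let ?c = "\<lambda>f :: 'k fls. fls_compose_power f n"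
  have c: "ring_map ?c" using assms(2) by (rule ring_map_fls_compose_power)
  have pb: "pullback n B = of_nat n *m map_matrix ?c B" for B :: "'k fls^'n^'n"
    by (simp add: vec_eq_iff pullback_def)
  have "of_nat n * ?c (fls_X * fls_deriv f) = fls_X * fls_deriv (?c f)" for f :: "'k fls"
  proof (rule fls_eqI)
    fix m
    have "of_nat n * of_int (m div int n) = (of_int m :: 'k)" if "int n dvd m"
      using that by (metis dvd_mult_div_cancel of_int_mult of_int_of_nat_eq)
    moreover define F where "F = fls_X * fls_deriv f"
    then have "fls_nth F k = of_int k * fls_nth f k" for k by (simp only: fls_nth_euler)
    ultimately have "fls_nth (of_nat n * ?c F) m = fls_nth (fls_X * fls_deriv (?c f)) m"
      unfolding fls_nth_euler
      using assms(2) by (simp add: fls_nth_of_nat_mult fls_nth_compose_power mult.assoc[symmetric])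
    then show "fls_nth (of_nat n * ?c (fls_X * fls_deriv f)) m = fls_nth (fls_X * fls_deriv (?c f)) m"
      unfolding F_def .
  qed
  then have euler: "of_nat n *m map_matrix ?c (fls_euler g) = fls_euler (map_matrix ?c g)"
    by (simp add: vec_eq_iff fls_euler_def)
  have "g ** A + fls_euler g = gauge g A ** g" using gauge_eq_iff[OF assms(1)] by blast
  then have "of_nat n *m map_matrix ?c (g ** A + fls_euler g) = of_nat n *m map_matrix ?c (gauge g A ** g)"
    by simp
  then have "map_matrix ?c g ** pullback n A + fls_euler (map_matrix ?c g)
      = pullback n (gauge g A) ** map_matrix ?c g"
    by (simp add: map_matrix_add[OF c] map_matrix_mult[OF c] scale_mat_right_distribs euler pb
        scale_mat_mult_left scale_mat_mult_right)
  then show ?thesis using gauge_eq_iff[OF invertible_map_matrix[OF c assms(1)]] by metis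
qed

lemma pullback_coeff:
  fixes A :: "'k::field fls^'n^'n"
  assumes "n > 0"
  shows "map_matrix (\<lambda>f. fls_nth f m) (pullback n A)
    = (if int n dvd m then of_nat n *m map_matrix (\<lambda>f. fls_nth f (m div int n)) A else 0)"
  using assms by (simp add: vec_eq_iff pullback_def fls_nth_of_nat_mult fls_nth_compose_power)

lemma pullback_connections:
  assumes "subgroup G GL" "n > 0" "A \<in> connections G"
  shows "pullback n A \<in> connections G"
  using assms(3) by (auto simp: connections_def pullback_coeff[OF assms(2)] lie_algebra_scale[OF assms(1)]
      lie_algebra_0[OF assms(1)])

lemma pullback_log_connections:
  assumes "subgroup G GL" "n > 0" "A \<in> log_connections G"
  shows "pullback n A \<in> log_connections G"
proof -
  have "m div int n < 0" if "m < 0" for m using div_neg_pos_less0[OF that] assms(2) by simp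
  then show ?thesis
    using assms by (auto simp: log_connections_def pullback_connections pullback_coeff)
qed

section \<open>The rational part of the residue\<close>

text \<open>The rational numbers are a direct summand of \<open>k\<close> as a vector space over \<open>\<rat>\<close>.\<close>

lemma rational_projection:
  obtains f :: "'k::field_char_0 \<Rightarrow> rat"
  where "\<And>x y. f (x + y) = f x + f y" "\<And>q x. f (of_rat q * x) = q * f x" "f 1 = 1"
proof -
  interpret vector_space_pair "\<lambda>(q::rat) (x::'k). of_rat q * x" "(*) :: rat \<Rightarrow> rat \<Rightarrow> rat"
    by unfold_locales (simp_all add: algebra_simps of_rat_add of_rat_mult)
  have "vs1.independent {1 :: 'k}" by (rule vs1.independent_insertI) (simp_all add: vs1.independent_empty)
  from linear_independent_extend[OF this, of "\<lambda>_. 1"]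
  obtain f where f: "Vector_Spaces.linear (\<lambda>(q::rat) (x::'k). of_rat q * x) (*) f" "f 1 = (1::rat)"
    by blast
  interpret f: Vector_Spaces.linear "\<lambda>(q::rat) (x::'k). of_rat q * x" "(*)" f by (rule f(1))
  show ?thesis using that[of f] f.add f.scale f(2) by blast
qed

lemma common_denominator:
  assumes "finite (S :: rat set)"
  obtains n :: nat where "n > 0" "\<And>q. q \<in> S \<Longrightarrow> of_nat n * q \<in> \<int>"
proof -
  have "\<exists>n::nat. n > 0 \<and> (\<forall>q\<in>S. of_nat n * q \<in> \<int>)"
    using assms
  proof (induction S rule: finite_induct)
    case (insert q S)
    then obtain n :: nat where n: "n > 0" "\<forall>q\<in>S. of_nat n * q \<in> \<int>" by blast
    obtain a b where ab: "quotient_of q = (a, b)" by (cases "quotient_of q")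
    have b: "b > 0" and q: "q = of_int a / of_int b"
      using quotient_of_denom_pos[OF ab] quotient_of_div[OF ab] by simp_all
    have nb: "of_nat (nat b) = (of_int b :: rat)" using b by simp
    have "of_nat (n * nat b) * q = of_int (int n * a)" using b by (simp add: q nb)
    then have "of_nat (n * nat b) * q \<in> \<int>" by (metis Ints_of_int)
    moreover have "of_nat (n * nat b) * r \<in> \<int>" if "r \<in> S" for r
    proof -
      have "of_nat (n * nat b) * r = of_int b * (of_nat n * r)" using nb by simp
      then show ?thesis using n(2) that by (metis Ints_mult Ints_of_int)
    qed
    ultimately show ?case using n(1) b by (intro exI[of _ "n * nat b"]) auto
  qed (auto intro: exI[of _ 1])
  then show ?thesis using that by blast
qed

text \<open>Since \<open>(A - c - m) Y Z = ((ad A - m) Y) Z + Y ((A - c) Z)\<close>, each factor \<open>A - c - m\<close> uses up one of the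
  \<open>d\<close> factors that kill \<open>Y\<close> or one of the \<open>e\<close> factors that kill \<open>Z\<close>. So elements of a generalised
  eigenspace of \<open>ad A\<close> shift the generalised eigenspaces of \<open>A\<close>.\<close>

lemma shifted_ad_kill:
  fixes A Y Z :: "'k::comm_ring_1^'n^'n"
  assumes "(shifted_ad A m ^^ d) Y = 0" "matpow (A - mat c) e ** Z = 0"
  shows "matpow (A - mat (c + m)) (d + e) ** (Y ** Z) = 0"
  using assms
proof (induction "d + e" arbitrary: d e Y Z)
  case (Suc k)
  show ?case
  proof (cases "d = 0 \<or> e = 0")
    case True
    then show ?thesis using Suc.prems by auto
  next
    case False
    then obtain d' e' where de: "d = Suc d'" "e = Suc e'" by (metis not0_implies_Suc)
    let ?M = "A - mat (c + m)"
    have comm: "matpow M (Suc j) = matpow M j ** M" for M :: "'k^'n^'n" and j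
      using matpow_commute[of M M j] by simp
    have Y': "(shifted_ad A m ^^ d') (shifted_ad A m Y) = 0"
      using Suc.prems(1) by (simp add: de funpow_Suc_right del: funpow.simps)
    have Z': "matpow (A - mat c) e' ** ((A - mat c) ** Z) = 0"
      using Suc.prems(2) unfolding de comm by (simp add: matrix_mul_assoc)
    have "k = d' + e" "k = d + e'" using Suc.hyps(2) de by simp_all
    then have "matpow ?M k ** (shifted_ad A m Y ** Z) = 0" "matpow ?M k ** (Y ** ((A - mat c) ** Z)) = 0"
      using Suc.hyps(1)[OF _ Y' Suc.prems(2)] Suc.hyps(1)[OF _ Suc.prems(1) Z'] by simp_all
    moreover have "?M ** (Y ** Z) = shifted_ad A m Y ** Z + Y ** ((A - mat c) ** Z)"
      by (simp add: mat_alg mat_add matrix_mul_assoc)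
    ultimately have "matpow ?M k ** (?M ** (Y ** Z)) = 0" by (simp only: matrix_add_ldistrib) simp
    then show ?thesis unfolding Suc.hyps(2)[symmetric] comm by (simp add: matrix_mul_assoc)
  qed
qed simp

lemma spectral_blocks:
  fixes A Y :: "'k::field^'n^'n"
  assumes Y: "(shifted_ad A m ^^ d) Y = 0"
    and P: "\<And>c. \<exists>e. matpow (A - mat c) e ** P c = 0" "\<And>c. A ** P c = P c ** A"
    and ne: "P a ** Y ** P b \<noteq> 0"
  shows "a = b + m"
proof (rule ccontr)
  assume neq: "a \<noteq> b + m"
  obtain i where i: "matpow (A - mat a) i ** P a = 0" using P(1) by blast
  obtain j where j: "matpow (A - mat b) j ** P b = 0" using P(1) by blast
  have "(A - mat (b + m)) ** P a = P a ** (A - mat (b + m))"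
    by (simp add: mat_alg mat_add P(2))
  then have "matpow (A - mat (b + m)) (d + j) ** (P a ** (Y ** P b))
      = P a ** (matpow (A - mat (b + m)) (d + j) ** (Y ** P b))"
    by (metis matrix_mul_assoc matpow_commute)
  also have "\<dots> = 0" by (simp add: shifted_ad_kill[OF Y j])
  finally have "matpow (A - mat (b + m)) (d + j) ** (P a ** Y ** P b) = 0"
    by (simp add: matrix_mul_assoc)
  moreover have "matpow (A - mat a) i ** (P a ** Y ** P b) = 0"
    using i by (simp add: matrix_mul_assoc)
  ultimately show False using generalised_eigenspaces_disjoint neq ne by blast
qed

text \<open>An eigenvector of \<open>ad X\<close> for \<open>c\<close> maps some generalised eigenspace of \<open>X\<close>, for \<open>a\<close> say, to a nonzero
  subspace of the one for \<open>a + c\<close>.\<close>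

lemma ad_eigenvalue_difference:
  fixes X :: "'k::alg_closed_field^'n^'n"
  assumes "ad_eigenvalue G X c"
  obtains a where "mat_eigenvalue X a" "mat_eigenvalue X (a + c)"
proof -
  obtain Y where Y: "Y \<noteq> 0" "X ** Y - Y ** X = c *m Y"
    using assms by (auto simp: ad_eigenvalue_def scale_mat_def)
  obtain P where P: "mat 1 = (\<Sum>a | mat_eigenvalue X a. P a)"
    "\<And>a. \<exists>e. matpow (X - mat a) e ** P a = 0" "\<And>a. P a \<noteq> 0 \<Longrightarrow> mat_eigenvalue X a"
    by (rule spectral_projections[of X]) blast
  have "Y = (\<Sum>a | mat_eigenvalue X a. Y ** P a)"
    by (metis P(1) matrix_mul_rid matrix_sum_ldistrib)
  then obtain a where a: "Y ** P a \<noteq> 0" using Y(1) by (metis (no_types, lifting) sum.neutral)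
  then have "mat_eigenvalue X a" using P(3) by force
  moreover have "mat_eigenvalue X (a + c)"
  proof -
    obtain e where e: "matpow (X - mat a) e ** P a = 0" using P(2) by blast
    have "(shifted_ad X c ^^ 1) Y = 0" using Y(2) by simp
    from shifted_ad_kill[OF this e] have "matpow (X - mat (a + c)) (1 + e) ** (Y ** P a) = 0" .
    then obtain i where "matpow (X - mat (a + c)) i ** (Y ** P a) \<noteq> 0"
      "X ** (matpow (X - mat (a + c)) i ** (Y ** P a))
        = (a + c) *m (matpow (X - mat (a + c)) i ** (Y ** P a))"
      using a by (rule eigenvector_of_generalised)
    then show ?thesis unfolding mat_eigenvalue_def by blast
  qed
  ultimately show ?thesis by (rule that)
qed

section \<open>Shearing to zero standard form\<close>

lemma fls_X_intpow_add: "fls_X_intpow (a + b) = fls_X_intpow a * (fls_X_intpow b :: 'a::comm_ring_1 fls)"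
  by (rule fls_eqI) (simp add: fls_X_intpow_times_conv_shift)

lemma fls_euler_intpow_const:
  "fls_X * fls_deriv (fls_X_intpow j * fls_const c) = fls_X_intpow j * fls_const (of_int j * c :: 'a::comm_ring_1)"
  by (rule fls_eqI) (simp add: fls_nth_euler fls_X_intpow_times_conv_shift del: fls_deriv_nth)

lemma fls_euler_sum: "fls_euler (sum f S) = (\<Sum>i\<in>S. fls_euler (f i))"
  by (simp add: vec_eq_iff fls_euler_def sum_matrix_nth fls_deriv_sum sum_distrib_left)

lemma fls_matrix_eqI:
  "(\<And>m. map_matrix (\<lambda>f. fls_nth f m) A = map_matrix (\<lambda>f. fls_nth f m) B) \<Longrightarrow> A = B"
  by (simp add: vec_eq_iff fls_eq_iff)

text \<open>\<open>R j\<close> is the sum of the projections onto the generalised eigenspaces of \<open>A\<close> for the eigenvalues \<open>c\<close>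
  with \<open>f c = j\<close>. The last conclusion is about the operator \<open>D\<close> with eigenvalue \<open>j\<close> on the image of
  \<open>R j\<close>: it is a replica of \<open>A\<close>, and the character \<open>c \<mapsto> 1 + \<epsilon> f c\<close> shows that it lies in the Lie
  algebra.\<close>

lemma level_projections:
  fixes A :: "'k::{alg_closed_field, field_char_0}^'n^'n" and f :: "'k \<Rightarrow> rat"
  assumes int: "\<And>c. mat_eigenvalue A c \<Longrightarrow> f c \<in> \<int>"
    and add: "\<And>x y. f (x + y) = f x + f y" and of_rat: "\<And>q. f (of_rat q) = q"
    and G: "subgroup G GL" and A: "A \<in> lie_algebra G"
  obtains J R where "finite J" "mat 1 = (\<Sum>j\<in>J. R j)"
    "\<forall>i j. R i ** R j = (if i = j then R j else 0)"
    "\<forall>j. A ** R j = R j ** A"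
    "\<forall>Y m d i j. (shifted_ad A (of_nat m) ^^ d) Y = 0 \<longrightarrow> R i ** Y ** R j \<noteq> 0 \<longrightarrow> i = j + int m"
    "\<forall>j c. \<forall>W :: 'k^'n^'n. A ** (R j ** W) = c *m (R j ** W) \<longrightarrow> R j ** W \<noteq> 0 \<longrightarrow> f c = of_int j"
    "(\<Sum>j\<in>J. of_int j *m R j) \<in> lie_algebra G"
proof -
  obtain P where P: "mat 1 = (\<Sum>c | mat_eigenvalue A c. P c)"
    "\<And>c. \<exists>e. matpow (A - mat c) e ** P c = 0"
    "\<And>c. A ** P c = P c ** A"
    "\<And>c d. c \<noteq> d \<Longrightarrow> P c ** P d = 0"
    "\<And>c. P c \<noteq> 0 \<Longrightarrow> mat_eigenvalue A c"
    by (rule spectral_projections[of A]) blast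
  define E where "E = {c. mat_eigenvalue A c}"
  have E: "finite E" unfolding E_def by (rule finite_eigenvalues)
  have one: "mat 1 = (\<Sum>c\<in>E. P c)" using P(1) E_def by simp
  define lev where "lev c = \<lfloor>f c\<rfloor>" for c
  have lev: "of_int (lev c) = f c" if "c \<in> E" for c
    using int[of c] that by (auto simp: lev_def E_def elim!: Ints_cases)
  define J where "J = lev ` E"
  define R where "R j = (\<Sum>c | c \<in> E \<and> lev c = j. P c)" for j
  have fin: "finite {c. c \<in> E \<and> lev c = j}" for j using E by simp
  have J: "finite J" using E by (simp add: J_def)
  have sumR: "mat 1 = (\<Sum>j\<in>J. R j)"
    unfolding one R_def J_def by (rule sum.image_gen[OF E])
  have R_outside: "R j = 0" if "j \<notin> J" for j
    using that by (auto simp: R_def J_def intro!: sum.neutral)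
  have ortho: "R i ** R j = 0" if "i \<noteq> j" for i j
    unfolding R_def matrix_sum_rdistrib matrix_sum_ldistrib
    using that by (auto intro!: sum.neutral P(4))
  have idem: "R j ** R j = R j" for j
  proof (cases "j \<in> J")
    case True
    have "R j = (\<Sum>i\<in>J. R j ** R i)" by (metis sumR matrix_mul_rid matrix_sum_ldistrib)
    also have "\<dots> = (\<Sum>i\<in>J. if i = j then R j ** R j else 0)" by (rule sum.cong) (auto simp: ortho)
    finally show ?thesis using J True by simp
  qed (simp add: R_outside)
  have PR: "P c ** R j = (if c \<in> E \<and> lev c = j then P c else 0)" for c j
  proof -
    have PP: "P c ** P c = P c" if "c \<in> E" for c
    proof -
      have "P c = (\<Sum>d\<in>E. P c ** P d)" by (metis one matrix_mul_rid matrix_sum_ldistrib)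
      also have "\<dots> = (\<Sum>d\<in>E. if d = c then P c ** P c else 0)" by (rule sum.cong) (auto simp: P(4))
      finally show ?thesis using E that by simp
    qed
    have "P c ** R j = (\<Sum>d | d \<in> E \<and> lev d = j. if d = c then P c else 0)"
      unfolding R_def matrix_sum_ldistrib by (rule sum.cong) (auto simp: PP P(4))
    then show ?thesis using fin by simp
  qed
  have blocks: "i = j + int m"
    if Y: "(shifted_ad A (of_nat m) ^^ d) Y = 0" and ne: "R i ** Y ** R j \<noteq> 0" for Y m d i j
  proof -
    have "\<exists>a b. a \<in> E \<and> lev a = i \<and> b \<in> E \<and> lev b = j \<and> P a ** Y ** P b \<noteq> 0"
    proof (rule ccontr)
      assume "\<not> ?thesis"
      then have "(\<Sum>b | b \<in> E \<and> lev b = j. \<Sum>a | a \<in> E \<and> lev a = i. P a ** Y ** P b) = 0"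
        by (intro sum.neutral ballI) auto
      then show False using ne by (simp add: R_def matrix_sum_ldistrib matrix_sum_rdistrib)
    qed
    then obtain b a where ab: "a \<in> E" "lev a = i" "b \<in> E" "lev b = j" "P a ** Y ** P b \<noteq> 0"
      by blast
    have "a = b + of_nat m" by (rule spectral_blocks[OF Y P(2,3) ab(5)])
    then have "f a = f b + of_nat m" using of_rat[of "of_nat m"] by (simp add: add)
    then have "of_int i = (of_int (j + int m) :: rat)" using lev ab by force
    then show ?thesis by (simp only: of_int_eq_iff)
  qed
  have eig: "f c = of_int j" if V: "A ** (R j ** W) = c *m (R j ** W)" "R j ** W \<noteq> 0" for j c and W :: "'k^'n^'n"
  proof -
    have "\<exists>a. a \<in> E \<and> lev a = j \<and> P a ** W \<noteq> 0"
    proof (rule ccontr)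
      assume "\<not> ?thesis"
      then have "(\<Sum>a | a \<in> E \<and> lev a = j. P a ** W) = 0" by (intro sum.neutral) auto
      then show False using V(2) by (simp add: R_def matrix_sum_rdistrib)
    qed
    then obtain a where a: "a \<in> E" "lev a = j" "P a ** W \<noteq> 0" by blast
    have PRW: "P a ** (R j ** W) = P a ** W" using a by (simp add: matrix_mul_assoc PR)
    have "A ** (P a ** W) = P a ** (A ** (R j ** W))" by (metis PRW P(3) matrix_mul_assoc)
    also have "\<dots> = c *m (P a ** W)" by (simp add: V(1) scale_mat_mult_right PRW)
    finally have kill_c: "matpow (A - mat c) 1 ** (P a ** W) = 0" by (simp add: mat_alg)
    obtain e where "matpow (A - mat a) e ** P a = 0" using P(2) by blast
    then have "matpow (A - mat a) e ** (P a ** W) = 0" by (simp add: matrix_mul_assoc)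
    then have "c = a" using generalised_eigenspaces_disjoint[OF kill_c] a(3) by blast
    then show ?thesis using lev[OF a(1)] a(2) by simp
  qed
  have D: "(\<Sum>j\<in>J. of_int j *m R j) \<in> lie_algebra G"
  proof -
    let ?\<kappa> = "\<lambda>c :: 'k. Dual 1 (of_rat (f c)) :: 'k dual"
    have "satisfies_ideal dual_const G (\<Sum>c\<in>E. ?\<kappa> c *m map_matrix dual_const (P c))"
    proof (rule replica_satisfies_ideal[OF G A, where h = "\<lambda>c. c"])
      show "ring_map (dual_const :: 'k \<Rightarrow> 'k dual)" by (rule ring_map_dual_const[OF ring_map_id])
      show "?\<kappa> 0 = 1" using add[of 0 0] by (simp add: one_dual_def)
      show "?\<kappa> (a + b) = ?\<kappa> a * ?\<kappa> b" for a b
        by (simp add: times_dual_def add of_rat_add add.commute)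
    qed (use E one P(2) in auto)
    moreover have "(\<Sum>c\<in>E. ?\<kappa> c *m map_matrix dual_const (P c))
        = dual_matrix (mat 1) (\<Sum>c\<in>E. of_rat (f c) *m P c)"
      by (simp add: vec_eq_iff sum_matrix_nth dual.expand one ring_map_sum[OF ring_map_dual_std]
          dual_eps_sum)
    moreover have "(\<Sum>c\<in>E. of_rat (f c) *m P c) = (\<Sum>j\<in>J. of_int j *m R j)"
    proof -
      have "(\<Sum>c\<in>E. of_rat (f c) *m P c)
          = (\<Sum>j\<in>J. \<Sum>c | c \<in> E \<and> lev c = j. of_rat (f c) *m P c)"
        unfolding J_def by (rule sum.image_gen[OF E])
      also have "\<dots> = (\<Sum>j\<in>J. of_int j *m R j)"
        unfolding R_def scale_mat_sum by (intro sum.cong refl) (auto simp: lev[symmetric])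
      finally show ?thesis .
    qed
    ultimately show ?thesis by (simp add: lie_algebra_iff_satisfies)
  qed
  have RR: "R i ** R j = (if i = j then R j else 0)" for i j by (simp add: ortho idem)
  have AR: "A ** R j = R j ** A" for j
    by (simp add: R_def matrix_sum_ldistrib matrix_sum_rdistrib P(3))
  show ?thesis
    by (rule that[OF J sumR _ _ _ _ D]) (use RR AR blocks eig in blast)+
qed

text \<open>A transformation to resonant normal form is followed by one with \<open>z\<^sup>-\<^sup>D\<close>. The replica lemma applies
  to \<open>D\<close> and the character \<open>j \<mapsto> z\<^sup>-\<^sup>j\<close> of the integers, and shows that \<open>z\<^sup>-\<^sup>D\<close> is a point of the
  group.\<close>

lemma zero_standard_form_of_integral_residue:
  fixes A :: "nat \<Rightarrow> 'k::{alg_closed_field, field_char_0}^'n^'n" and f :: "'k \<Rightarrow> rat"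
  assumes G: "subgroup G GL" and A: "\<And>m. A m \<in> lie_algebra G"
    and int: "\<And>c. mat_eigenvalue (A 0) c \<Longrightarrow> f c \<in> \<int>"
    and f_add: "\<And>x y. f (x + y) = f x + f y" and of_rat: "\<And>q. f (of_rat q) = q"
  obtains g X where "g \<in> points fls_const G" "X \<in> lie_algebra G"
    "gauge g (map_matrix fps_to_fls (fps_matrix A)) = map_matrix fls_const X"
    "\<forall>c\<in>\<rat>. ad_eigenvalue G X c \<longrightarrow> c = 0"
proof -
  obtain h B where h: "satisfies_ideal fps_const G h" "fps_coeff 0 h = mat 1"
    "h ** fps_matrix A + euler h = fps_matrix B ** h"
    and B: "\<And>m. B m \<in> lie_algebra G" "B 0 = A 0"
    "\<And>m. m > 0 \<Longrightarrow> \<exists>e. (shifted_ad (A 0) (of_nat m) ^^ e) (B m) = 0"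
    by (rule resonant_normal_form[of G A, OF G A]) blast
  obtain J R where J: "finite J" and one: "mat 1 = (\<Sum>j\<in>J. R j)"
    and RR': "\<forall>i j. R i ** R j = (if i = j then R j else 0)"
    and AR': "\<forall>j. A 0 ** R j = R j ** A 0"
    and blocks: "\<forall>Y m d i j. (shifted_ad (A 0) (of_nat m) ^^ d) Y = 0 \<longrightarrow> R i ** Y ** R j \<noteq> 0
      \<longrightarrow> i = j + int m"
    and eig: "\<forall>j c. \<forall>W :: 'k^'n^'n. A 0 ** (R j ** W) = c *m (R j ** W) \<longrightarrow> R j ** W \<noteq> 0
      \<longrightarrow> f c = of_int j"
    and D_lie: "(\<Sum>j\<in>J. of_int j *m R j) \<in> lie_algebra G"
    by (rule level_projections[of "A 0" f G, OF int f_add of_rat G A])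
  note RR = RR'[rule_format] and AR = AR'[rule_format]
  define D where "D = (\<Sum>j\<in>J. of_int j *m R j)"
  have D: "D \<in> lie_algebra G" using D_lie D_def by simp
  have R_outside: "R j = 0" if "j \<notin> J" for j
  proof -
    have "R j = (\<Sum>i\<in>J. R j ** R i)" by (metis one matrix_mul_rid matrix_sum_ldistrib)
    also have "\<dots> = 0" using that by (intro sum.neutral) (auto simp: RR)
    finally show ?thesis .
  qed
  have DR: "D ** R j = of_int j *m R j" and RD: "R j ** D = of_int j *m R j" for j
  proof -
    have "D ** R j = (\<Sum>i\<in>J. if i = j then of_int j *m R j else 0)"
      unfolding D_def matrix_sum_rdistrib by (rule sum.cong) (auto simp: scale_mat_mult RR)
    then show "D ** R j = of_int j *m R j" using J R_outside by simp
    have "R j ** D = (\<Sum>i\<in>J. if i = j then of_int j *m R j else 0)"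
      unfolding D_def matrix_sum_ldistrib by (rule sum.cong) (auto simp: scale_mat_mult RR)
    then show "R j ** D = of_int j *m R j" using J R_outside by simp
  qed
  have block: "i = j + int m" if "R i ** B m ** R j \<noteq> 0" for i j m
  proof (cases "m = 0")
    case True
    have "R i ** B m ** R j = R i ** R j ** A 0" using True B(2) AR by (simp add: matrix_mul_assoc[symmetric])
    then show ?thesis using that True by (auto simp: RR split: if_splits)
  next
    case False
    then show ?thesis using B(3) blocks that by blast
  qed
  have B_expand: "B m = (\<Sum>i\<in>J. \<Sum>j\<in>J. R i ** B m ** R j)" for m
  proof -
    have "B m = mat 1 ** B m ** mat 1" by simp
    also have "\<dots> = (\<Sum>i\<in>J. \<Sum>j\<in>J. R i ** B m ** R j)"
      unfolding one by (simp only: matrix_sum_rdistrib) (simp only: matrix_sum_ldistrib)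
    finally show ?thesis .
  qed
  \<comment> \<open>\<open>B m\<close> raises the level by \<open>m\<close>, and there are only finitely many levels.\<close>
  define M where "M = {m. B m \<noteq> 0}"
  have M: "finite M"
  proof (rule finite_subset)
    show "M \<subseteq> (\<lambda>(i, j). nat (i - j)) ` (J \<times> J)"
    proof
      fix m assume "m \<in> M"
      then have "(\<Sum>i\<in>J. \<Sum>j\<in>J. R i ** B m ** R j) \<noteq> 0" using B_expand[of m] M_def by auto
      then obtain i j where "i \<in> J" "j \<in> J" "R i ** B m ** R j \<noteq> 0"
        by (meson sum.neutral)
      then show "m \<in> (\<lambda>(i, j). nat (i - j)) ` (J \<times> J)"
        using block[of i m j] by (intro image_eqI[of _ _ "(i, j)"]) auto
    qed
  qed (use J in simp)
  define X where "X = (\<Sum>m\<in>M. B m) - D"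
  have X: "X \<in> lie_algebra G"
    unfolding X_def by (intro lie_algebra_diff[OF G] lie_algebra_sum[OF G] B D)

  \<comment> \<open>The matrix \<open>z\<^sup>-\<^sup>D\<close>.\<close>
  let ?c = "map_matrix (fls_const :: 'k \<Rightarrow> 'k fls)"
  define s where "s = (\<Sum>j\<in>J. fls_X_intpow (- j) *m ?c (R j))"
  have s_satisfies: "satisfies_ideal fls_const G s"
    unfolding s_def
  proof (rule replica_satisfies_ideal[OF G D, where h = of_int])
    show "inj (of_int :: int \<Rightarrow> 'k)" by (simp add: inj_def)
    show "\<exists>e. matpow (D - mat (of_int j)) e ** R j = 0" for j
      by (rule exI[of _ 1]) (simp add: mat_alg DR)
    show "fls_X_intpow (- (a + b)) = (fls_X_intpow (- a) * fls_X_intpow (- b) :: 'k fls)" for a b :: int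
      using fls_X_intpow_add[of "- a" "- b", where 'a = 'k] by simp
  qed (use J one ring_map_fls_const in auto)
  note c_mult = map_matrix_mult[OF ring_map_fls_const, symmetric]
  have s_inv: "(\<Sum>i\<in>J. fls_X_intpow (a * i) *m ?c (R i)) ** (\<Sum>j\<in>J. fls_X_intpow (- a * j) *m ?c (R j))
      = mat 1" for a
  proof -
    have "(\<Sum>i\<in>J. fls_X_intpow (a * i) *m ?c (R i)) ** (\<Sum>j\<in>J. fls_X_intpow (- a * j) *m ?c (R j))
        = (\<Sum>i\<in>J. \<Sum>j\<in>J. if j = i then ?c (R i) else 0)"
      unfolding matrix_sum_rdistrib unfolding matrix_sum_ldistrib
    proof (intro sum.cong refl)
      fix i j
      have "fls_X_intpow (a * i) * fls_X_intpow (- (a * i)) = (1 :: 'k fls)"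
        using fls_X_intpow_add[of "a * i" "- (a * i)", where 'a = 'k] by simp
      moreover have "?c (0 :: 'k^'n^'n) = 0" by (simp add: vec_eq_iff)
      ultimately show "fls_X_intpow (a * i) *m ?c (R i) ** (fls_X_intpow (- a * j) *m ?c (R j))
          = (if j = i then ?c (R i) else 0)"
        by (auto simp: scale_mat_mult c_mult RR mult.commute)
    qed
    also have "\<dots> = ?c (mat 1)"
      using J by (simp add: one map_matrix_sum[OF ring_map_fls_const])
    finally show ?thesis by (simp add: map_matrix_mat)
  qed
  have "invertible s"
    unfolding invertible_def s_def
    using s_inv[of "-1"] s_inv[of 1] by (intro exI[of _ "\<Sum>i\<in>J. fls_X_intpow i *m ?c (R i)"]) simp
  then have s: "s \<in> points fls_const G" using s_satisfies by (simp add: points_iff)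
  have euler_s: "fls_euler s = - (?c D ** s)"
  proof -
    have "fls_euler s = (\<Sum>j\<in>J. - (?c D ** (fls_X_intpow (- j) *m ?c (R j))))"
      unfolding s_def fls_euler_sum
    proof (rule sum.cong)
      fix j
      have "fls_euler (fls_X_intpow (- j) *m ?c (R j)) = fls_X_intpow (- j) *m ?c (of_int (- j) *m R j)"
        unfolding vec_eq_iff fls_euler_def nth_map_matrix scale_mat_nth fls_euler_intpow_const
        by simp
      also have "?c (of_int (- j) *m R j) = - (?c D ** ?c (R j))"
        by (simp add: c_mult DR scale_mat_left_distribs) (simp add: vec_eq_iff)
      finally show "fls_euler (fls_X_intpow (- j) *m ?c (R j))
          = - (?c D ** (fls_X_intpow (- j) *m ?c (R j)))"
        by (simp add: scale_mat_mult_right scale_mat_right_distribs)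
    qed simp
    then show ?thesis by (simp add: s_def matrix_sum_ldistrib sum_negf)
  qed
  have s_B: "fls_X_intpow (int m) *m (s ** ?c (B m)) = ?c (B m) ** s" for m
  proof -
    have left: "s ** ?c (B m) = (\<Sum>i\<in>J. \<Sum>j\<in>J. fls_X_intpow (- i) *m ?c (R i ** B m ** R j))"
    proof -
      have "R i ** B m = (\<Sum>j\<in>J. R i ** B m ** R j)" for i
        by (metis one matrix_mul_rid matrix_sum_ldistrib)
      then have "s ** ?c (B m) = (\<Sum>i\<in>J. fls_X_intpow (- i) *m ?c (\<Sum>j\<in>J. R i ** B m ** R j))"
        by (simp add: s_def matrix_sum_rdistrib scale_mat_mult c_mult)
      then show ?thesis by (simp add: map_matrix_sum[OF ring_map_fls_const] scale_mat_sum)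
    qed
    have right: "?c (B m) ** s = (\<Sum>i\<in>J. \<Sum>j\<in>J. fls_X_intpow (- j) *m ?c (R i ** B m ** R j))"
    proof -
      have "B m ** R j = (\<Sum>i\<in>J. R i ** B m ** R j)" for j
        by (metis one matrix_mul_lid matrix_sum_rdistrib matrix_mul_assoc)
      then have "?c (B m) ** s = (\<Sum>j\<in>J. fls_X_intpow (- j) *m ?c (\<Sum>i\<in>J. R i ** B m ** R j))"
        by (simp add: s_def matrix_sum_ldistrib scale_mat_mult c_mult)
      then show ?thesis
        by (subst sum.swap) (simp add: map_matrix_sum[OF ring_map_fls_const] scale_mat_sum)
    qed
    have "fls_X_intpow (int m) *m (fls_X_intpow (- i) *m ?c (R i ** B m ** R j))
        = fls_X_intpow (- j) *m ?c (R i ** B m ** R j)" for i j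
    proof (cases "R i ** B m ** R j = 0")
      case True
      then have "?c (R i ** B m ** R j) = 0" by (simp add: vec_eq_iff)
      then show ?thesis by simp
    next
      case False
      then have "i = j + int m" by (rule block)
      then have "fls_X_intpow (int m) * fls_X_intpow (- i) = (fls_X_intpow (- j) :: 'k fls)"
        by (simp only: fls_X_intpow_add[symmetric]) simp
      then show ?thesis by (simp add: scale_mat_scale_mat)
    qed
    then show ?thesis by (simp add: left right scale_mat_sum)
  qed
  have B_series: "map_matrix fps_to_fls (fps_matrix B) = (\<Sum>m\<in>M. fls_X_intpow (int m) *m ?c (B m))"
  proof (rule fls_matrix_eqI)
    fix n
    have nth_sum: "map_matrix (\<lambda>f. fls_nth f n) (sum F S) = (\<Sum>i\<in>S. map_matrix (\<lambda>f. fls_nth f n) (F i))"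
      for F :: "nat \<Rightarrow> 'k fls^'n^'n" and S
    proof -
      have "fls_nth (sum u S) n = (\<Sum>i\<in>S. fls_nth (u i) n)" for u :: "nat \<Rightarrow> 'k fls"
        by (induction S rule: infinite_finite_induct) simp_all
      then show ?thesis by (simp add: vec_eq_iff sum_matrix_nth)
    qed
    have "map_matrix (\<lambda>f. fls_nth f n) (\<Sum>m\<in>M. fls_X_intpow (int m) *m ?c (B m))
        = (\<Sum>m\<in>M. if m = nat n then (if n < 0 then 0 else B m) else 0)"
      unfolding nth_sum by (rule sum.cong) (auto simp: vec_eq_iff fls_X_intpow_times_conv_shift)
    also have "\<dots> = (if n < 0 then 0 else B (nat n))" using M by (auto simp: M_def)
    also have "\<dots> = map_matrix (\<lambda>f. fls_nth f n) (map_matrix fps_to_fls (fps_matrix B))"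
      by (simp add: vec_eq_iff fps_matrix_def)
    finally show "map_matrix (\<lambda>f. fls_nth f n) (map_matrix fps_to_fls (fps_matrix B))
      = map_matrix (\<lambda>f. fls_nth f n) (\<Sum>m\<in>M. fls_X_intpow (int m) *m ?c (B m))" by simp
  qed
  let ?h = "map_matrix fps_to_fls h"
  have h_points: "?h \<in> points fls_const G" by (rule fps_points[OF h(1,2)])
  have gauge_h: "gauge ?h (map_matrix fps_to_fls (fps_matrix A)) = map_matrix fps_to_fls (fps_matrix B)"
  proof -
    have "map_matrix fps_to_fls (h ** fps_matrix A + euler h) = map_matrix fps_to_fls (fps_matrix B ** h)"
      using h(3) by simp
    then show ?thesis using h_points
      by (subst gauge_eq_iff)
        (simp_all add: points_iff fls_euler_fps_to_fls map_matrix_add[OF ring_map_fps_to_fls]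
          map_matrix_mult[OF ring_map_fps_to_fls])
  qed
  have gauge_s: "gauge s (map_matrix fps_to_fls (fps_matrix B)) = ?c X"
  proof (subst gauge_eq_iff[OF \<open>invertible s\<close>])
    have "s ** map_matrix fps_to_fls (fps_matrix B) = (\<Sum>m\<in>M. ?c (B m) ** s)"
      unfolding B_series by (simp add: matrix_sum_ldistrib scale_mat_mult s_B)
    then show "s ** map_matrix fps_to_fls (fps_matrix B) + fls_euler s = ?c X ** s"
      by (simp add: euler_s X_def map_matrix_diff[OF ring_map_fls_const]
          map_matrix_sum[OF ring_map_fls_const] matrix_sum_rdistrib matrix_distribs)
  qed

  \<comment> \<open>The component of lowest level of an eigenvector of \<open>X\<close> is an eigenvector of \<open>A 0 - D\<close>, since
    the \<open>B m\<close> with \<open>m > 0\<close> raise the level.\<close>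
  have X_eig: "f c = 0" if eigenvalue: "mat_eigenvalue X c" for c
  proof -
    obtain W :: "'k^'n^'n" where W: "W \<noteq> 0" "X ** W = c *m W" using eigenvalue by (auto simp: mat_eigenvalue_def)
    have expand: "W = (\<Sum>j\<in>J. R j ** W)" by (metis one matrix_mul_lid matrix_sum_rdistrib)
    define K where "K = {j \<in> J. R j ** W \<noteq> 0}"
    have "K \<noteq> {}"
    proof
      assume "K = {}"
      then have "(\<Sum>j\<in>J. R j ** W) = 0" by (intro sum.neutral) (auto simp: K_def)
      then show False using expand W(1) by simp
    qed
    moreover have K: "finite K" using J by (simp add: K_def)
    ultimately have minK: "Min K \<in> K" by (intro Min_in)
    define j where "j = Min K"
    have j: "R j ** W \<noteq> 0" using minK by (simp add: j_def K_def)
    have low: "R i ** W = 0" if "i \<in> J" "i < j" for i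
      using that Min_le[OF K, of i] by (force simp: j_def K_def)
    have RB: "R j ** B m ** W = 0" if "m > 0" for m
    proof -
      have "R j ** B m ** W = (\<Sum>i\<in>J. R j ** B m ** R i ** W)"
        by (subst expand) (simp add: matrix_sum_ldistrib matrix_mul_assoc)
      also have "\<dots> = 0"
      proof (rule sum.neutral, rule ballI)
        fix i assume i: "i \<in> J"
        show "R j ** B m ** R i ** W = 0"
        proof (cases "R j ** B m ** R i = 0")
          case False
          then have "i < j" using block[of j m i] \<open>m > 0\<close> by simp
          then show ?thesis using low[OF i] by (simp add: matrix_mul_assoc[symmetric])
        qed simp
      qed
      finally show ?thesis .
    qed
    have "(\<Sum>m\<in>M. R j ** B m ** W) = R j ** B 0 ** W"
    proof -
      have "(\<Sum>m\<in>M. R j ** B m ** W) = (\<Sum>m\<in>M. if m = 0 then R j ** B 0 ** W else 0)"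
        by (rule sum.cong) (auto simp: RB)
      then show ?thesis using M by (auto simp: M_def)
    qed
    then have "R j ** (X ** W) = A 0 ** (R j ** W) - of_int j *m (R j ** W)"
      by (simp add: X_def matrix_distribs matrix_sum_ldistrib matrix_sum_rdistrib matrix_mul_assoc RD
          scale_mat_mult B(2) AR)
    moreover have "R j ** (X ** W) = c *m (R j ** W)" by (simp add: W(2) scale_mat_mult)
    ultimately have "A 0 ** (R j ** W) = (c + of_int j) *m (R j ** W)"
      by (simp add: scale_mat_left_distribs algebra_simps)
    from eig[rule_format, OF this j] have "f (c + of_int j) = of_int j" .
    moreover have "f (of_int j) = of_int j" using of_rat[of "of_int j"] by simp
    ultimately show ?thesis by (simp add: f_add)
  qed
  have "c = 0" if c: "c \<in> \<rat>" "ad_eigenvalue G X c" for c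
  proof -
    obtain q where q: "c = of_rat q" using c(1) by (auto elim: Rats_cases)
    obtain a where "mat_eigenvalue X a" "mat_eigenvalue X (a + c)"
      using c(2) by (rule ad_eigenvalue_difference)
    then have "f a = 0" "f (a + c) = 0" by (simp_all only: X_eig)
    then show ?thesis by (simp add: f_add q of_rat)
  qed
  moreover have "s ** ?h \<in> points fls_const G" by (rule points_mult[OF G s h_points])
  moreover have "gauge (s ** ?h) (map_matrix fps_to_fls (fps_matrix A)) = ?c X"
    using h_points by (simp add: gauge_mult[OF _ \<open>invertible s\<close>] points_iff gauge_h gauge_s)
  ultimately show ?thesis using that X by blast
qed

theorem theorem4p10:
  fixes G :: "('k::{alg_closed_field, field_char_0}^'n^'n) set"
    and A :: "'k fls^'n^'n"
  assumes "linear_algebraic_group G"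
    and "zariski_connected G"
    and "reductive G"
    and "regular_connection G A"
  shows "\<exists>n>0. \<exists>B. zero_standard_form G B \<and> gauge_equivalent G (pullback n A) B"
proof -
  have G: "subgroup G GL" using assms(1) by (simp add: linear_algebraic_group_def)
  obtain L g where L: "L \<in> log_connections G" and A: "A \<in> connections G"
    and g: "g \<in> points fls_const G" "gauge g A = L"
    using assms(4) by (auto simp: regular_connection_def gauge_equivalent_def)
  define A0 where "A0 = map_matrix (\<lambda>u. fls_nth u 0) L"
  obtain f :: "'k \<Rightarrow> rat" where f: "\<And>x y. f (x + y) = f x + f y" "\<And>q x. f (of_rat q * x) = q * f x"
    "f 1 = 1" by (rule rational_projection) blast
  obtain n :: nat where n: "n > 0" "\<And>q. q \<in> f ` {c. mat_eigenvalue A0 c} \<Longrightarrow> of_nat n * q \<in> \<int>"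
    using common_denominator[OF finite_imageI[OF finite_eigenvalues]] by metis
  define a where "a m = map_matrix (\<lambda>u. fls_nth u (int m)) (pullback n L)" for m
  have log: "pullback n L \<in> log_connections G" by (rule pullback_log_connections[OF G n(1) L])
  have a_lie: "a m \<in> lie_algebra G" for m
    using log by (simp add: a_def log_connections_def connections_def)
  have series: "map_matrix fps_to_fls (fps_matrix a) = pullback n L"
  proof (rule fls_matrix_eqI)
    fix m
    have "map_matrix (\<lambda>u. fls_nth u m) (pullback n L) = 0" if "m < 0"
      using log that by (simp add: log_connections_def)
    then show "map_matrix (\<lambda>u. fls_nth u m) (map_matrix fps_to_fls (fps_matrix a))
        = map_matrix (\<lambda>u. fls_nth u m) (pullback n L)"
      by (auto simp: vec_eq_iff fps_matrix_def a_def)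
  qed
  \<comment> \<open>The residue is multiplied by \<open>n\<close>, which clears the denominators.\<close>
  have a0: "a 0 = of_nat n *m A0" by (simp add: a_def pullback_coeff[OF n(1)] A0_def)
  have integral: "f c \<in> \<int>" if eig: "mat_eigenvalue (a 0) c" for c
  proof -
    obtain W :: "'k^'n^'n" where W: "W \<noteq> 0" "of_nat n *m (A0 ** W) = c *m W"
      using eig by (auto simp: mat_eigenvalue_def a0 scale_mat_mult)
    have "A0 ** W = inverse (of_nat n) *m (of_nat n *m (A0 ** W))"
      using n(1) by (simp add: scale_mat_scale_mat)
    also have "\<dots> = (c / of_nat n) *m W"
      by (simp add: W(2) scale_mat_scale_mat divide_inverse mult.commute)
    finally have "mat_eigenvalue A0 (c / of_nat n)" using W(1) by (auto simp: mat_eigenvalue_def)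
    then have "of_nat n * f (c / of_nat n) \<in> \<int>" using n(2) by blast
    moreover have "f c = of_nat n * f (c / of_nat n)"
      using f(2)[of "of_nat n" "c / of_nat n"] n(1) by simp
    ultimately show ?thesis by simp
  qed
  have of_rat: "f (of_rat q) = q" for q using f(2)[of q 1] f(3) by simp
  obtain h X where h: "h \<in> points fls_const G" "X \<in> lie_algebra G"
    "gauge h (map_matrix fps_to_fls (fps_matrix a)) = map_matrix fls_const X"
    and rational: "\<forall>c\<in>\<rat>. ad_eigenvalue G X c \<longrightarrow> c = 0"
    by (rule zero_standard_form_of_integral_residue[of G a f, OF G a_lie integral f(1) of_rat])
  let ?g = "map_matrix (\<lambda>u. fls_compose_power u n) g"
  have g': "?g \<in> points fls_const G" by (rule points_compose_power[OF g(1) n(1)])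
  have "gauge ?g (pullback n A) = pullback n L"
    using pullback_gauge[of g n A] g n(1) by (simp add: points_iff)
  then have "gauge (h ** ?g) (pullback n A) = map_matrix fls_const X"
    using g' h(1,3) by (simp add: gauge_mult points_iff series)
  moreover have "h ** ?g \<in> points fls_const G" by (rule points_mult[OF G h(1) g'])
  moreover have "pullback n A \<in> connections G" by (rule pullback_connections[OF G n(1) A])
  moreover have "map_matrix fls_const X \<in> connections G"
  proof -
    have "map_matrix (\<lambda>u. fls_nth u m) (map_matrix fls_const X) = (if m = 0 then X else 0)" for m
      by (simp add: vec_eq_iff)
    then show ?thesis using h(2) lie_algebra_0[OF G] by (simp add: connections_def)
  qed
  ultimately have "gauge_equivalent G (pullback n A) (map_matrix fls_const X)"
    by (auto simp: gauge_equivalent_def)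
  moreover have "zero_standard_form G (map_matrix fls_const X)"
    using h(2) rational by (auto simp: zero_standard_form_def)
  ultimately show ?thesis using n(1) by blast
qed

end
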